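(* Let $f$ be a germ of a holomorphic self-map of $\mathbb{C}^2$ that is tangent to the identity at a fixed point $p$, has order $k+1$, and has a characteristic direction $[v]\in\mathbb{P}^1(\mathbb{C})$. Assume that $[v]$ is: (1) a characteristic direction of degree $s$, where $s\le\infty$; (2) non-degenerate of degree $r+1$, where $k<r<s$; and (3) of order one in degree $t+1$, where $k\le t\le r$. If $[v]$ is transversally attracting and $s>r+t-k$, then there exists a nonempty open set $D$ (a domain of attraction) with $f(D)\subset D$ such that for every $x\in D$, $f^n(x)\to p$ as $n\to\infty$ and $f^n(x)$ converges to $p$ along $[v]$, i.e. $[f^n(x)-p]\to[v]$ in $\mathbb{P}^1(\mathbb{C})$.
   Context: A germ $f$ of a holomorphic self-map of $\mathbb{C}^n$ fixing $p$ is tangent to the identity at $p$ if $df_p=\mathrm{Id}$. After translating $p$ to the origin, $f(x)=x+\sum_{j\ge k+1}P_j(x)$ with $P_j$ a homogeneous polynomial map of degree $j$ and $P_{k+1}\not\equiv0$; the integer $k+1\ge2$ is the order of $f$. For a homogeneous polynomial map $Q$, $[v]$ is a characteristic direction of $Q$ if $Q(v)=\lambda v$ for some $\lambda\in\mathbb{C}$, $v\ne0$; it is degenerate if $\lambda=0$ and non-degenerate if $\lambda\ne0$. A characteristic direction of $f$ is a characteristic direction of $P_{k+1}$. $[v]$ is a characteristic direction of degree $s$ if it is a characteristic direction of $P_{k+1},\dots,P_s$ (degree $\infty$: of all $P_j$). $[v]$ is non-degenerate of degree $r+1$ ($r>k$) if it is a degenerate characteristic direction of $P_{k+1},\dots,P_r$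 and a non-degenerate characteristic direction of $P_{r+1}$. Choose linear coordinates $(z,w)$ with $p=0$ and $[v]=[1:0]$, and write $P_j=(p_j,q_j)$; let $l_j$ be the order of vanishing of $q_j(1,u)$ at $u=0$. $[v]$ is of order one in degree $t+1$ if $l_{t+1}=1<l_j$ for all $k+1\le j\le t$. Under (1)–(3), in such coordinates one can write $f(z,w)=\big(z(1+z^rR(z))+wU(z,w),\ w(1+z^tT(z)+wV(z,w))+z^{s+1}S(z)\big)$ with $R,S,T,U,V$ holomorphic near $0$, $a:=R(0)\ne0$, $b:=T(0)\ne0$, $S(0)\neq 0$ (or $S\equiv0$ if $s=\infty$), $U=O(|(z,w)|^k)$, $V=O(|(z,w)|^{k-1})$. The director of $[v]$ is $\Delta=-b\,\alpha^t$, where $\alpha$ is an $r$-th root of $-1/(ar)$ (chosen so that $\mathrm{Re}\,\Delta>0$ whenever some choice allows it), if $t<r$; and $\Delta=\frac1r\big(\frac ba-(r-k+1)\big)$ if $t=r$. $[v]$ is transversally attracting if $\mathrm{Re}\,\Delta>0$. *)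

theory Defs
  imports "HOL-Analysis.Analysis" "HOL-Library.Extended_Nat"
begin

definition cmul :: "complex \<Rightarrow> complex \<times> complex \<Rightarrow> complex \<times> complex" where
  "cmul l x = (l * fst x, l * snd x)"

definition cdet :: "complex \<times> complex \<Rightarrow> complex \<times> complex \<Rightarrow> complex" where
  "cdet x y = fst x * snd y - snd x * fst y"

definition holo_germ_series ::
  "(complex \<times> complex \<Rightarrow> complex \<times> complex) \<Rightarrow> complex \<times> complex \<Rightarrow> real
     \<Rightarrow> (nat \<Rightarrow> nat \<Rightarrow> complex \<times> complex) \<Rightarrow> bool" where
  "holo_germ_series f p \<rho> c \<longleftrightarrow> 0 < \<rho> \<and>
     (\<forall>x \<in> ball 0 \<rho>.
        ((\<lambda>(i,j). fst (c i j) * fst x ^ i * snd x ^ j) has_sum fst (f (p + x))) UNIV \<and>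
        ((\<lambda>(i,j). snd (c i j) * fst x ^ i * snd x ^ j) has_sum snd (f (p + x))) UNIV)"

definition hpart :: "(nat \<Rightarrow> nat \<Rightarrow> complex \<times> complex) \<Rightarrow> nat \<Rightarrow> complex \<times> complex \<Rightarrow> complex \<times> complex" where
  "hpart c j x =
     ((\<Sum>i\<le>j. fst (c i (j - i)) * fst x ^ i * snd x ^ (j - i)),
      (\<Sum>i\<le>j. snd (c i (j - i)) * fst x ^ i * snd x ^ (j - i)))"

definition char_dir :: "(complex \<times> complex \<Rightarrow> complex \<times> complex) \<Rightarrow> complex \<times> complex \<Rightarrow> bool" where
  "char_dir Q v \<longleftrightarrow> v \<noteq> 0 \<and> (\<exists>l. Q v = cmul l v)"

definition degenerate_char_dir :: "(complex \<times> complex \<Rightarrow> complex \<times> complex) \<Rightarrow> complex \<times> complex \<Rightarrow> bool" where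
  "degenerate_char_dir Q v \<longleftrightarrow> v \<noteq> 0 \<and> Q v = cmul 0 v"

definition nondegenerate_char_dir :: "(complex \<times> complex \<Rightarrow> complex \<times> complex) \<Rightarrow> complex \<times> complex \<Rightarrow> bool" where
  "nondegenerate_char_dir Q v \<longleftrightarrow> v \<noteq> 0 \<and> (\<exists>l. l \<noteq> 0 \<and> Q v = cmul l v)"

definition char_dir_of_degree :: "(nat \<Rightarrow> nat \<Rightarrow> complex \<times> complex) \<Rightarrow> nat \<Rightarrow> enat \<Rightarrow> complex \<times> complex \<Rightarrow> bool" where
  "char_dir_of_degree c k s v \<longleftrightarrow> (\<forall>j. k + 1 \<le> j \<and> enat j \<le> s \<longrightarrow> char_dir (hpart c j) v)"

definition nondeg_of_degree :: "(nat \<Rightarrow> nat \<Rightarrow> complex \<times> complex) \<Rightarrow> nat \<Rightarrow> nat \<Rightarrow> complex \<times> complex \<Rightarrow> bool" where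
  "nondeg_of_degree c k r v \<longleftrightarrow> k < r \<and>
     (\<forall>j. k + 1 \<le> j \<and> j \<le> r \<longrightarrow> degenerate_char_dir (hpart c j) v) \<and>
     nondegenerate_char_dir (hpart c (r + 1)) v"

text \<open>In linear coordinates (z,w) with [v] = [1:0] and second basis vector w0, the function
  q_j(1,u) equals  cdet v (P_j (v + u w0)) / cdet v w0.\<close>
definition qfun :: "(nat \<Rightarrow> nat \<Rightarrow> complex \<times> complex) \<Rightarrow> complex \<times> complex \<Rightarrow> complex \<times> complex
     \<Rightarrow> nat \<Rightarrow> complex \<Rightarrow> complex" where
  "qfun c v w0 j u = cdet v (hpart c j (v + cmul u w0)) / cdet v w0"

definition vanish_order_one :: "(complex \<Rightarrow> complex) \<Rightarrow> bool" where
  "vanish_order_one g \<longleftrightarrow> g 0 = 0 \<and> deriv g 0 \<noteq> 0"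

definition vanish_order_gt_one :: "(complex \<Rightarrow> complex) \<Rightarrow> bool" where
  "vanish_order_gt_one g \<longleftrightarrow> g 0 = 0 \<and> deriv g 0 = 0"

definition order_one_in_degree :: "(nat \<Rightarrow> nat \<Rightarrow> complex \<times> complex) \<Rightarrow> nat \<Rightarrow> nat
     \<Rightarrow> complex \<times> complex \<Rightarrow> complex \<times> complex \<Rightarrow> bool" where
  "order_one_in_degree c k t v w0 \<longleftrightarrow>
     vanish_order_one (qfun c v w0 (t + 1)) \<and>
     (\<forall>j. k + 1 \<le> j \<and> j \<le> t \<longrightarrow> vanish_order_gt_one (qfun c v w0 j))"

text \<open>Transversally attracting: Re Delta > 0 for the director Delta (for t < r, for some
  choice of the r-th root alpha of -1/(a r)).\<close>
definition transv_attracting :: "nat \<Rightarrow> nat \<Rightarrow> nat \<Rightarrow> complex \<Rightarrow> complex \<Rightarrow> bool" where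
  "transv_attracting k r t a b \<longleftrightarrow>
     (if t < r then (\<exists>\<alpha>. \<alpha> ^ r = - 1 / (a * of_nat r) \<and> Re (- b * \<alpha> ^ t) > 0)
      else Re ((b / a - (of_nat r - of_nat k + 1)) / of_nat r) > 0)"

text \<open>[y_n - p] \<rightarrow> [v] in P^1(C): eventually y_n \<noteq> p and suitable representatives converge to v.\<close>
definition converges_along :: "(nat \<Rightarrow> complex \<times> complex) \<Rightarrow> complex \<times> complex \<Rightarrow> complex \<times> complex \<Rightarrow> bool" where
  "converges_along y p v \<longleftrightarrow> eventually (\<lambda>n. y n \<noteq> p) sequentially \<and>
     (\<exists>\<mu> :: nat \<Rightarrow> complex. ((\<lambda>n. cmul (\<mu> n) (y n - p)) \<longlongrightarrow> v) sequentially)"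

end

theory Submission
  imports Defs "HOL-Computational_Algebra.Polynomial"
begin

text \<open>
  In coordinates $(z,w)$ with $[v] = [1:0]$ and in the region $|w| \le |z|$ the hypotheses say that
  $f(z,w) = (z + a z^{r+1} + O(|z|^{r+2} + |w||z|^k),\
    w + b w z^t + O(|w||z|^{t+1} + |w|^2|z|^{k-1} + |z|^{r+t-k+2}))$.
  Let $\alpha^r = -1/(ar)$ and let $m$ be slightly larger than $r-k+1$. If $|w| < |z|^m$, all error
  terms become negligible: the first component is a one-dimensional parabolic map with attracting
  axis $\alpha$, so a thin sector around this axis is invariant. On this sector $|w|/|z|^m$ is
  multiplied by approximately $|1 + b z^t|\,|1 + a z^r|^{-m}$, which is less than $1$ because the
  director has positive real part (for $t = r$ the condition is $\mathrm{Re}(b/a) > m$, which still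
  holds for $m$ close to $r-k+1$). Hence $|w| < |z|^m$ over the sector is the required domain, and as
  $m > 1$ the orbits are tangent to $[v]$.
\<close>

section \<open>Invariant region over a sector\<close>

text \<open>The exponent \<open>m\<close> has a window of width one. The term of size |w||z|^k in
  the first component must be small against |z|^(r+1), which forces m > r-k+1. The pure powers of z
  in the second component do not shrink with w; they must be small against |z|^(m+t), and since s >
  r+t-k they begin in degree r+t-k+2 at the earliest, which leaves room for m < r-k+2. With m =
  r-k+1+\<epsilon> both requirements hold with relative error |z|^\<epsilon> as soon as \<epsilon>
  \<le> 1/2. These pure powers are also why errors in the second component are measured against the
  bound |z|^m and not against |w|. For t < r the factor |1 + a z^r|^(-m) deviates from 1 only in
  higher order than |1 + b z^t|, so any m in the window serves. For t = r the two compete, and the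
  constant r-k+1 in the director is the lower end of the window. The first component is treated
  through a logarithm: F = z exp L with L close to a z^r, so that Re L governs the modulus and Im L
  the argument.\<close>

lemma tendsto_0_if_contracting:
  fixes q :: "nat \<Rightarrow> real"
  assumes nonneg: "\<And>n. 0 \<le> q n" and \<kappa>: "0 < \<kappa>"
    and step: "\<And>n. q (Suc n) \<le> q n * exp (- \<kappa> * q n ^ r)"
  shows "q \<longlonglongrightarrow> 0"
proof -
  have "q (Suc n) \<le> q n" for n
  proof -
    have "exp (- \<kappa> * q n ^ r) \<le> 1"
      using \<kappa> nonneg by simp
    then show ?thesis
      using step[of n] mult_left_le[OF _ nonneg, of _ n] by fastforce
  qed
  then have "decseq q"
    by (rule decseq_SucI)
  then obtain L where L: "q \<longlonglongrightarrow> L"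
    using decseq_convergent[of q 0] nonneg by blast
  have "L \<ge> 0"
    using L nonneg by (simp add: LIMSEQ_le_const)
  have "(\<lambda>n. q n * exp (- \<kappa> * q n ^ r)) \<longlonglongrightarrow> L * exp (- \<kappa> * L ^ r)"
    by (intro tendsto_intros L)
  then have "L \<le> L * exp (- \<kappa> * L ^ r)"
    using LIMSEQ_le[OF LIMSEQ_Suc[OF L]] step by blast
  moreover have "L * exp (- \<kappa> * L ^ r) < L * 1" if "L > 0"
    using that \<kappa> by (intro mult_strict_left_mono) auto
  ultimately have "L = 0"
    using \<open>L \<ge> 0\<close> by (metis linorder_not_le mult.right_neutral order_le_less)
  then show ?thesis
    using L by simp
qed

lemma norm_Ln_one_plus_minus_le:
  fixes e :: complex
  assumes "norm e \<le> 1/2"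
  shows "norm (Ln (1 + e) - e) \<le> 2 * (norm e)\<^sup>2"
proof -
  have "norm (Ln (1 + e) - e) \<le> (norm e)\<^sup>2 / (1 - norm e)"
    using assms by (intro Ln_approx_linear) simp
  also have "\<dots> \<le> (norm e)\<^sup>2 / (1/2)"
    using assms by (intro divide_left_mono) auto
  finally show ?thesis by simp
qed

text \<open>Since |1+x|^2 = 1 + 2 (Re x + |x|^2/2), completing the square gives the bound even with
  |x|^2/2. The base is nonnegative because (|x|-1)^2 \<ge> 0, so no smallness of x is required. It
  isolates the first-order term Re x, which decides whether |w| shrinks relative to |z|^m.\<close>

lemma norm_one_plus_le:
  fixes x :: complex
  shows "norm (1 + x) \<le> 1 + Re x + (norm x)\<^sup>2"
proof (rule power2_le_imp_le)
  have "\<bar>Re x\<bar> \<le> norm x" by (rule abs_Re_le_cmod)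
  then have 1: "0 \<le> 1 + Re x + (norm x)\<^sup>2 / 2"
    using zero_le_power2[of "norm x - 1"] by (simp add: power2_eq_square algebra_simps)
  then show "0 \<le> 1 + Re x + (norm x)\<^sup>2"
    by (smt (verit) zero_le_power2 field_sum_of_halves)
  have "(norm (1 + x))\<^sup>2 = 1 + 2 * Re x + (norm x)\<^sup>2"
    unfolding cmod_power2 by (simp add: power2_eq_square algebra_simps)
  also have "\<dots> \<le> (1 + (Re x + (norm x)\<^sup>2 / 2))\<^sup>2"
    using zero_le_power2[of "Re x + (norm x)\<^sup>2 / 2"] unfolding power2_sum[of 1] by simp
  also have "\<dots> \<le> (1 + Re x + (norm x)\<^sup>2)\<^sup>2"
    using 1 by (intro power_mono) auto
  finally show "(norm (1 + x))\<^sup>2 \<le> (1 + Re x + (norm x)\<^sup>2)\<^sup>2" .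
qed

text \<open>The dynamical core, for arbitrary functions \<open>F\<close> and \<open>G\<close>: germs
  and coordinates enter only through the two estimates. To first order ln |w| changes by Re (b z^t)
  and ln (|z|^m) by m Re (a z^r); the conditional in \<open>director\<close> reflects that the
  second change has the order of the first only if t = r. The exponential factor in the conclusion
  later forces orbits to 0.\<close>

lemma attracting_region:
  fixes F G :: "complex \<Rightarrow> complex \<Rightarrow> complex" and a b \<alpha> :: complex and m C \<epsilon> \<delta>0 :: real
  assumes a: "a \<noteq> 0" and rt: "1 \<le> t" "t \<le> r" and \<alpha>: "\<alpha> ^ r = - 1 / (a * of_nat r)"
    and nums: "0 \<le> m" "0 \<le> C" "0 < \<epsilon>" "\<epsilon> \<le> 1" "0 < \<delta>0"
    and director: "Re ((b - (if t = r then of_real m * a else 0)) * \<alpha> ^ t) < 0"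
    and F: "\<And>z w. \<lbrakk>0 < norm z; norm z < \<delta>0; norm w < norm z powr m\<rbrakk> \<Longrightarrow>
      norm (F z w - (z + a * z ^ (r + 1))) \<le> C * norm z ^ (r + 1) * norm z powr \<epsilon>"
    and G: "\<And>z w. \<lbrakk>0 < norm z; norm z < \<delta>0; norm w < norm z powr m\<rbrakk> \<Longrightarrow>
      norm (G z w - (w + b * w * z ^ t)) \<le> C * norm z powr m * norm z ^ t * norm z powr \<epsilon>"
  obtains \<phi> \<delta> \<kappa> :: real where "0 < \<phi>" "\<phi> < pi" "0 < \<delta>" "\<delta> \<le> \<delta>0" "0 < \<kappa>"
    "\<And>z w. \<lbrakk>0 < norm z; norm z < \<delta>; \<bar>Arg (z / \<alpha>)\<bar> < \<phi>; norm w < norm z powr m\<rbrakk> \<Longrightarrow>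
      0 < norm (F z w) \<and> norm (F z w) \<le> norm z * exp (- \<kappa> * norm z ^ r) \<and>
      \<bar>Arg (F z w / \<alpha>)\<bar> < \<phi> \<and> norm (G z w) < norm (F z w) powr m"
proof -
  define A where "A = norm a"
  define \<sigma> where "\<sigma> = sgn \<alpha>"
  have "A > 0" using a by (simp add: A_def)
  have "\<alpha> \<noteq> 0"
  proof
    assume "\<alpha> = 0"
    then have "\<alpha> ^ r = 0" using rt by simp
    then show False using \<alpha> a rt by simp
  qed
  have \<alpha>_eq: "\<alpha> = of_real (norm \<alpha>) * \<sigma>"
    using \<open>\<alpha> \<noteq> 0\<close> by (simp add: \<sigma>_def sgn_eq)
  have a\<alpha>: "a * \<alpha> ^ r = - (1 / of_nat r)"
    using \<alpha> a by simp
  have "norm (a * \<alpha> ^ r) = 1 / of_nat r"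
    unfolding a\<alpha> by (simp add: norm_divide)
  then have A\<alpha>: "A * norm \<alpha> ^ r = 1 / of_nat r"
    by (simp add: A_def norm_mult norm_power)
  \<comment> \<open>So a \<sigma>^r is the negative real number -A: on the axis the main term
    shrinks z without turning it.\<close>
  have "of_real (norm \<alpha> ^ r) * (a * \<sigma> ^ r) = a * \<alpha> ^ r"
    by (subst (2) \<alpha>_eq) (simp add: power_mult_distrib)
  also have "\<dots> = of_real (norm \<alpha> ^ r) * - of_real A"
    unfolding a\<alpha> using arg_cong[OF A\<alpha>, of complex_of_real] by (simp add: mult.commute)
  finally have a\<sigma>: "a * \<sigma> ^ r = - of_real A"
    by (rule mult_left_cancel[THEN iffD1, rotated]) (simp add: \<open>\<alpha> \<noteq> 0\<close>)
  define g0 where "g0 = b * \<sigma> ^ t + (if t = r then of_real (m * A) else 0)"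
  have g0_eq: "g0 = (b - (if t = r then of_real m * a else 0)) * \<sigma> ^ t"
    by (simp add: g0_def left_diff_distrib mult.assoc a\<sigma>)
  have "Re ((b - (if t = r then of_real m * a else 0)) * \<alpha> ^ t) = norm \<alpha> ^ t * Re g0"
    unfolding g0_eq by (subst (1) \<alpha>_eq)
      (simp add: power_mult_distrib mult.left_commute flip: of_real_power del: of_real_power)
  from director[unfolded this] have "Re g0 < 0"
    using \<open>\<alpha> \<noteq> 0\<close> by (auto simp: mult_less_0_iff)
  define c0 where "c0 = - Re g0 / 2"
  have "c0 > 0" using \<open>Re g0 < 0\<close> by (simp add: c0_def)

  \<comment> \<open>On the axis one step changes \<open>ln (norm w / norm z powr m)\<close> by about \<open>Re g0 * norm z ^ t\<close>;
    in a thin sector this stays negative.\<close>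
  have "((\<lambda>h. Re (g0 * cis (of_nat t * h))) \<longlongrightarrow> Re (g0 * cis (of_nat t * 0))) (at 0)"
    by (intro tendsto_intros)
  then have "eventually (\<lambda>h. Re (g0 * cis (of_nat t * h)) < - c0) (at 0)"
    using \<open>Re g0 < 0\<close> by (intro order_tendstoD(2)[of _ "Re g0"]) (auto simp: c0_def)
  then obtain \<phi>1 where \<phi>1: "\<phi>1 > 0" "\<And>h. h \<noteq> 0 \<Longrightarrow> \<bar>h\<bar> < \<phi>1 \<Longrightarrow> Re (g0 * cis (of_nat t * h)) < - c0"
    unfolding eventually_at by (auto simp: dist_real_def)
  \<comment> \<open>The second bound keeps |r h| below pi/3, where cos (r h) \<ge> 1/2 and sin is
    increasing.\<close>
  define \<phi> where "\<phi> = min \<phi>1 (pi / (3 * r))"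
  have "\<phi> > 0" using \<phi>1 rt by (simp add: \<phi>_def)
  have Re_g0: "Re (g0 * cis (of_nat t * h)) < - c0" if "\<bar>h\<bar> < \<phi>" for h
    using \<phi>1(2)[of h] that \<open>Re g0 < 0\<close> by (cases "h = 0") (auto simp: \<phi>_def c0_def)
  have r\<phi>: "r * \<phi> \<le> pi / 3"
  proof -
    have "r * \<phi> \<le> r * (pi / (3 * r))" by (intro mult_left_mono) (auto simp: \<phi>_def)
    then show ?thesis using rt by simp
  qed
  have "1 * \<phi> \<le> r * \<phi>"
    using rt \<open>\<phi> > 0\<close> by (intro mult_right_mono) auto
  then have \<phi>_le: "\<phi> \<le> pi / 3" using r\<phi> by simp
  \<comment> \<open>\<open>s\<close> bounds sin (r |h|) from below on the outer half of the sector;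
    it measures the rotation back towards the axis.\<close>
  define s where "s = sin (r * \<phi> / 2)"
  have "s > 0"
    unfolding s_def
  proof (rule sin_gt_zero)
    show "0 < r * \<phi> / 2" using \<open>\<phi> > 0\<close> rt by simp
    show "r * \<phi> / 2 < pi" using r\<phi> pi_gt_zero by linarith
  qed

  \<comment> \<open>With e the relative increment of z, q = |z| and g = q^\<epsilon>:
    \<open>K\<close> bounds |e| / q^r, and \<open>E\<close> bounds |Ln (1 + e) - a z^r| / (q^r g).
    \<open>B\<close> collects the errors of size q^t g when |G| is compared with |F|^m: the z^r term
    for t < r, the square in \<open>norm_one_plus_le\<close>, the error of \<open>G\<close>, and m
    times the error of the logarithm.\<close>
  define K where "K = A + C"
  define E where "E = C + 2 * K\<^sup>2"
  define B where "B = m * A + (norm b)\<^sup>2 + C + m * E"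
  have pos: "K > 0" "E \<ge> 0" "B \<ge> 0"
    using \<open>A > 0\<close> nums by (auto simp: K_def E_def B_def intro!: add_nonneg_nonneg)
  \<comment> \<open>The thresholds serve, in order: |e| \<le> 1/2, short angular steps, decrease of
    the modulus, rotation towards the axis at the edge, and contraction of |w| / |z|^m. Dividing by
    2 N makes each of 1, K, E, B times \<open>\<gamma>\<close> fall below all of them, and the
    radius \<open>\<gamma> powr (1 / \<epsilon>)\<close> ensures |z|^\<epsilon> < \<gamma>.\<close>
  define \<mu> where "\<mu> = Min {1, \<phi> / 4, A / 4, A * s, c0}"
  define N where "N = 1 + K + E + B"
  define \<gamma> where "\<gamma> = \<mu> / 2 / N"
  have "N > 0" using pos by (simp add: N_def)
  have "\<mu> > 0"
    unfolding \<mu>_def using \<open>A > 0\<close> \<open>\<phi> > 0\<close> \<open>s > 0\<close> \<open>c0 > 0\<close> by (subst Min_gr_iff) auto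
  then have "\<gamma> > 0" using \<open>N > 0\<close> by (simp add: \<gamma>_def)
  have small: "X * \<gamma> < \<mu>" "2 * (X * \<gamma>) \<le> \<mu>" if "0 \<le> X" "X \<le> N" for X
  proof -
    have "X * \<gamma> \<le> N * \<gamma>"
      using that \<open>\<gamma> > 0\<close> by (intro mult_right_mono) auto
    also have "\<dots> = \<mu> / 2"
      using \<open>N > 0\<close> by (simp add: \<gamma>_def)
    finally show "X * \<gamma> < \<mu>" "2 * (X * \<gamma>) \<le> \<mu>" using \<open>\<mu> > 0\<close> by auto
  qed
  have \<mu>: "\<mu> \<le> 1" "\<mu> \<le> \<phi> / 4" "\<mu> \<le> A / 4" "\<mu> \<le> A * s" "\<mu> \<le> c0"
    by (auto simp: \<mu>_def)
  have \<gamma>: "\<gamma> < 1" "2 * (K * \<gamma>) \<le> 1" "K * \<gamma> < \<phi> / 4" "E * \<gamma> < A / 4" "E * \<gamma> < A * s" "B * \<gamma> < c0"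
    using small[of 1] small[of K] small[of E] small[of B] \<mu> pos by (auto simp: N_def)
  define \<delta> where "\<delta> = min \<delta>0 (\<gamma> powr (1 / \<epsilon>))"
  have "\<delta> > 0" "\<delta> \<le> \<delta>0"
    using nums \<open>\<gamma> > 0\<close> by (auto simp: \<delta>_def)

  have main: "0 < norm (F z w) \<and> norm (F z w) \<le> norm z * exp (- (A / 4) * norm z ^ r) \<and>
      \<bar>Arg (F z w / \<alpha>)\<bar> < \<phi> \<and> norm (G z w) < norm (F z w) powr m"
    if z: "0 < norm z" "norm z < \<delta>" and h_less: "\<bar>Arg (z / \<alpha>)\<bar> < \<phi>" and w: "norm w < norm z powr m"
    for z w
  proof -
    define q where "q = norm z"
    define h where "h = Arg (z / \<alpha>)"
    define g where "g = q powr \<epsilon>"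
    have q: "0 < q" "q < \<delta>0" "q < \<gamma> powr (1 / \<epsilon>)"
      using z by (auto simp: q_def \<delta>_def)
    have "g < (\<gamma> powr (1 / \<epsilon>)) powr \<epsilon>"
      unfolding g_def using q nums by (intro powr_less_mono2) auto
    then have g: "0 < g" "g < \<gamma>"
      using q nums \<open>\<gamma> > 0\<close> by (auto simp: g_def powr_powr)
    have "\<gamma> powr (1 / \<epsilon>) \<le> 1"
      using \<gamma> \<open>\<gamma> > 0\<close> nums by (intro powr_le1) auto
    then have "q < 1" using q by linarith
    \<comment> \<open>Because \<epsilon> \<le> 1, every positive integer power of q is also
      dominated by g.\<close>
    have "q powr 1 \<le> q powr \<epsilon>"
      using q \<open>q < 1\<close> nums by (intro powr_mono') auto
    then have "q \<le> g" using q by (simp add: g_def)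
    have qn: "q ^ n \<le> g" if "n \<ge> 1" for n
    proof -
      have "q ^ n \<le> q ^ 1"
        using q \<open>q < 1\<close> that by (intro power_decreasing) auto
      then show ?thesis using \<open>q \<le> g\<close> by simp
    qed
    have h: "\<bar>h\<bar> < \<phi>" using h_less by (simp add: h_def)
    have z_eq: "z = of_real q * \<sigma> * cis h"
    proof -
      have "z = \<alpha> * (of_real (norm (z / \<alpha>)) * cis h)"
        using rcis_cmod_Arg[of "z / \<alpha>"] \<open>\<alpha> \<noteq> 0\<close> by (simp add: h_def rcis_def)
      also have "\<dots> = of_real q * (of_real (norm \<alpha> / norm \<alpha>) * \<sigma>) * cis h"
        by (subst (1) \<alpha>_eq) (simp add: q_def norm_divide)
      finally show ?thesis using \<open>\<alpha> \<noteq> 0\<close> by simp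
    qed
    have z_pow: "z ^ n = of_real (q ^ n) * (\<sigma> ^ n * cis (of_nat n * h))" for n
      by (subst z_eq) (simp add: power_mult_distrib Complex.DeMoivre)
    have az: "a * z ^ r = - of_real (A * q ^ r) * cis (of_nat r * h)"
    proof -
      have "a * z ^ r = of_real (q ^ r) * ((a * \<sigma> ^ r) * cis (of_nat r * h))"
        unfolding z_pow by (simp add: algebra_simps)
      then show ?thesis by (simp add: a\<sigma>)
    qed
    have q_pow: "0 < q ^ n" for n using q by simp
    note q_pow[of r, simp] q_pow[of t, simp]
    have norm_\<sigma>: "norm \<sigma> = 1"
      using \<open>\<alpha> \<noteq> 0\<close> by (simp add: \<sigma>_def norm_sgn)
    have "z \<noteq> 0" using z by auto

    define e where "e = F z w / z - 1"
    have F_eq: "F z w = z * (1 + e)"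
      using \<open>z \<noteq> 0\<close> by (simp add: e_def)
    have "q * norm (e - a * z ^ r) = norm (F z w - (z + a * z ^ (r + 1)))"
      unfolding q_def norm_mult[symmetric] F_eq by (simp add: algebra_simps)
    also have "\<dots> \<le> C * q ^ (r + 1) * g"
      using F[of z w] q w by (simp add: q_def g_def)
    finally have "q * norm (e - a * z ^ r) \<le> q * (C * (q ^ r * g))"
      by (simp add: algebra_simps)
    then have e_az: "norm (e - a * z ^ r) \<le> C * (q ^ r * g)"
      using q by simp
    have norm_az: "norm (a * z ^ r) = A * q ^ r"
      by (simp add: A_def q_def norm_mult norm_power)
    have "C * (q ^ r * g) \<le> C * (q ^ r * 1)"
      using nums g \<gamma> q by (intro mult_left_mono) auto
    then have e_le: "norm e \<le> K * q ^ r"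
      using norm_triangle_sub[of e "a * z ^ r"] e_az norm_az by (simp add: K_def algebra_simps)
    also have "\<dots> \<le> K * g"
      using qn[of r] rt pos by (intro mult_left_mono) auto
    finally have "norm e \<le> K * g" .
    moreover have "K * g \<le> K * \<gamma>" using g pos by simp
    ultimately have e_small: "norm e \<le> K * \<gamma>" by linarith
    then have "norm e \<le> 1/2" using \<gamma> by linarith
    have "(norm e)\<^sup>2 \<le> (K * q ^ r) * (K * g)"
      unfolding power2_eq_square using e_le \<open>norm e \<le> K * g\<close> pos q by (intro mult_mono) auto
    then have e2: "(norm e)\<^sup>2 \<le> K\<^sup>2 * (q ^ r * g)"
      by (simp add: power2_eq_square mult_ac)
    have "1 + e \<noteq> 0"
    proof
      assume "1 + e = 0"
      then have "e = - 1" by (simp add: add_eq_0_iff)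
      then show False using \<open>norm e \<le> 1/2\<close> by simp
    qed
    \<comment> \<open>The logarithm turns the step z to z (1 + e) into an addition: Re L is the
      change of ln |z| and Im L the change of the argument.\<close>
    define L where "L = Ln (1 + e)"
    have L_e: "norm (L - e) \<le> 2 * (norm e)\<^sup>2"
      unfolding L_def using \<open>norm e \<le> 1/2\<close> by (rule norm_Ln_one_plus_minus_le)
    have L_az: "norm (L - a * z ^ r) \<le> E * (q ^ r * g)"
      using norm_triangle_ineq[of "L - e" "e - a * z ^ r"] L_e e_az e2 by (simp add: E_def algebra_simps)
    have exp_L: "exp L = 1 + e"
      using \<open>1 + e \<noteq> 0\<close> by (simp add: L_def)

    have "\<bar>Re (L - a * z ^ r)\<bar> \<le> E * (q ^ r * g)"
      using abs_Re_le_cmod L_az by (rule order_trans)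
    then have Re_L: "\<bar>Re L + A * q ^ r * cos (r * h)\<bar> \<le> E * (q ^ r * g)"
      by (simp add: az)
    have "\<bar>Im (L - a * z ^ r)\<bar> \<le> E * (q ^ r * g)"
      using abs_Im_le_cmod L_az by (rule order_trans)
    then have Im_L: "\<bar>Im L + A * q ^ r * sin (r * h)\<bar> \<le> E * (q ^ r * g)"
      by (simp add: az)
    have Eg: "E * (q ^ r * g) \<le> q ^ r * (E * \<gamma>)"
      using pos g by (simp add: mult.left_commute mult_left_mono)

    have rh: "\<bar>r * h\<bar> < pi / 3"
    proof -
      have "\<bar>r * h\<bar> = r * \<bar>h\<bar>" by (simp add: abs_mult)
      also have "\<dots> < r * \<phi>" using h rt by simp
      finally show ?thesis using r\<phi> by simp
    qed
    have "cos (pi / 3) \<le> cos \<bar>r * h\<bar>"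
      using rh pi_gt_zero by (intro cos_monotone_0_pi_le) auto
    then have cos_ge: "1/2 \<le> cos (r * h)"
      by (simp add: cos_60)
    \<comment> \<open>The main term yields at least A/2 because cos (r h) \<ge> 1/2; the error may
      consume A/4, and the rest is the rate \<open>\<kappa>\<close>.\<close>
    have "Re L \<le> - (A / 4) * q ^ r"
    proof -
      have "q ^ r * (E * \<gamma>) \<le> q ^ r * (A / 4)"
        using \<gamma> q by (intro mult_left_mono) auto
      then have "E * (q ^ r * g) \<le> A * q ^ r / 4"
        using Eg by (simp only: mult_ac times_divide_eq_left times_divide_eq_right)
      moreover have "A * q ^ r * (1/2) \<le> A * q ^ r * cos (r * h)"
        using cos_ge \<open>A > 0\<close> q by (intro mult_left_mono) auto
      ultimately show ?thesis using abs_le_D1[OF Re_L] by linarith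
    qed
    moreover have norm_F: "norm (F z w) = q * exp (Re L)"
      unfolding F_eq norm_mult exp_L[symmetric] by (simp add: q_def)
    ultimately have 1: "norm (F z w) \<le> q * exp (- (A / 4) * q ^ r)" "0 < norm (F z w)"
      using q by auto

    have Im_small: "\<bar>Im L\<bar> < \<phi> / 2"
    proof -
      have "norm e * norm e \<le> norm e * (1/2)"
        using \<open>norm e \<le> 1/2\<close> by (intro mult_left_mono) auto
      then have "norm L \<le> 2 * norm e"
        using norm_triangle_sub[of L e] L_e by (simp add: power2_eq_square)
      then show ?thesis using abs_Im_le_cmod[of L] e_small \<gamma> by linarith
    qed
    have Es: "q ^ r * (E * \<gamma>) < q ^ r * (A * s)"
      using \<gamma> by (intro mult_strict_left_mono) auto
    have sin_ge: "s \<le> sin (r * x)" if "\<phi> / 2 \<le> x" "x < \<phi>" for x :: real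
    proof -
      have "r * (\<phi> / 2) \<le> r * x" "r * x \<le> r * \<phi>"
        using that by (intro mult_left_mono; simp)+
      then show ?thesis
        unfolding s_def using r\<phi> \<open>\<phi> > 0\<close> by (intro sin_monotone_2pi_le) (auto intro: order_trans)
    qed
    \<comment> \<open>Near the boundary of the sector \<open>Im L\<close> points towards the axis; near the axis a step is too
      short to leave the sector.\<close>
    have "\<bar>h + Im L\<bar> < \<phi>"
    proof (cases "\<bar>h\<bar> < \<phi> / 2")
      case False
      then consider "\<phi> / 2 \<le> h" | "\<phi> / 2 \<le> - h" by linarith
      then show ?thesis
      proof cases
        case 1
        then have "q ^ r * (A * s) \<le> q ^ r * (A * sin (r * h))"
          using sin_ge[of h] h \<open>A > 0\<close> q by (intro mult_left_mono) auto
        then have "q ^ r * (A * s) \<le> A * q ^ r * sin (r * h)"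
          by (simp add: mult_ac)
        then have "Im L < 0"
          using abs_le_D1[OF Im_L] Es Eg by linarith
        then show ?thesis using 1 h Im_small by linarith
      next
        case 2
        then have "q ^ r * (A * s) \<le> q ^ r * (A * sin (r * - h))"
          using sin_ge[of "- h"] h \<open>A > 0\<close> q by (intro mult_left_mono) auto
        then have "q ^ r * (A * s) \<le> - (A * q ^ r * sin (r * h))"
          by (simp add: mult_ac)
        then have "Im L > 0"
          using abs_le_D2[OF Im_L] Es Eg by linarith
        then show ?thesis using 2 h Im_small by linarith
      qed
    qed (use Im_small in linarith)
    moreover have "Arg (F z w / \<alpha>) = h + Im L"
    proof -
      have "Arg (1 + e) = Im L"
        using \<open>1 + e \<noteq> 0\<close> by (simp add: L_def Arg_eq_Im_Ln)
      \<comment> \<open>No wrap-around of the principal argument: the sum has already been confined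
        to (-\<phi>, \<phi>), and \<phi> \<le> pi/3.\<close>
      moreover have "Arg (z / \<alpha> * (1 + e)) = Arg (z / \<alpha>) + Arg (1 + e)"
        using \<open>1 + e \<noteq> 0\<close> \<open>z \<noteq> 0\<close> \<open>\<alpha> \<noteq> 0\<close> calculation \<open>\<bar>h + Im L\<bar> < \<phi>\<close> \<phi>_le pi_gt_zero
        by (intro Arg_times) (auto simp: h_def[symmetric])
      ultimately show ?thesis by (simp add: F_eq h_def)
    qed
    ultimately have 2: "\<bar>Arg (F z w / \<alpha>)\<bar> < \<phi>" by simp

    define X where "X = b * z ^ t"
    have X_le: "norm (1 + X) \<le> 1 + Re X + (norm b)\<^sup>2 * (q ^ t * g)"
    proof -
      have "(norm X)\<^sup>2 = (norm b)\<^sup>2 * (q ^ t * q ^ t)"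
        by (simp add: X_def q_def norm_mult norm_power power2_eq_square mult_ac)
      also have "\<dots> \<le> (norm b)\<^sup>2 * (q ^ t * g)"
        using qn[of t] rt q by (intro mult_left_mono) auto
      finally show ?thesis using norm_one_plus_le[of X] by linarith
    qed
    have qr: "q ^ r \<le> q ^ t"
      using q \<open>q < 1\<close> rt by (intro power_decreasing) auto
    \<comment> \<open>One form for both cases. For t = r the cosine term is part of
      \<open>g0\<close>; for t < r it is absorbed into the error, since q^(r-t) \<le> g.\<close>
    have Re_X: "Re X + m * A * q ^ r * cos (r * h) < - c0 * q ^ t + m * A * (q ^ t * g)"
    proof (cases "t = r")
      case True
      have "Re X + m * A * q ^ r * cos (r * h) = q ^ t * Re (g0 * cis (of_nat t * h))"
        using True by (simp add: X_def z_pow g0_def algebra_simps)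
      also have "\<dots> < q ^ t * - c0"
        using Re_g0[OF h] by (intro mult_strict_left_mono) auto
      also have "\<dots> \<le> - c0 * q ^ t + m * A * (q ^ t * g)"
        using nums \<open>A > 0\<close> g q by (simp add: mult.commute)
      finally show ?thesis .
    next
      case False
      have "q ^ r * cos (r * h) \<le> q ^ r * 1"
        using q by (intro mult_left_mono) auto
      also have "\<dots> = q ^ t * q ^ (r - t)"
        using rt by (simp add: power_add[symmetric])
      also have "\<dots> \<le> q ^ t * g"
        using False rt q qn[of "r - t"] by (intro mult_left_mono) auto
      finally have "m * A * (q ^ r * cos (r * h)) \<le> m * A * (q ^ t * g)"
        using nums \<open>A > 0\<close> by (intro mult_left_mono) auto
      moreover have "Re X = q ^ t * Re (g0 * cis (of_nat t * h))"
        using False by (simp add: X_def z_pow g0_def algebra_simps)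
      moreover have "q ^ t * Re (g0 * cis (of_nat t * h)) < q ^ t * - c0"
        using Re_g0[OF h] by (intro mult_strict_left_mono) auto
      ultimately show ?thesis by (simp add: mult_ac)
    qed
    have "m * (- (A * q ^ r * cos (r * h)) - E * (q ^ r * g)) \<le> m * Re L"
      using Re_L nums by (intro mult_left_mono) (auto simp: abs_le_iff)
    moreover have "m * (E * (q ^ r * g)) \<le> m * (E * (q ^ t * g))"
      using qr pos nums g by (intro mult_left_mono mult_right_mono) auto
    moreover have "B * g * q ^ t < c0 * q ^ t"
    proof -
      have "B * g \<le> B * \<gamma>" using pos g by (intro mult_left_mono) auto
      then show ?thesis using \<gamma> by (intro mult_strict_right_mono) auto
    qed
    \<comment> \<open>A linear comparison suffices: 1 + m Re L \<le> exp (m Re L) = (|F| / |z|)^m,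
      so convexity of exp works in the favourable direction.\<close>
    ultimately have key: "1 + Re X + (norm b)\<^sup>2 * (q ^ t * g) + C * (q ^ t * g) < 1 + m * Re L"
      using Re_X by (simp add: B_def algebra_simps)
    have "norm (G z w) \<le> norm (w * (1 + X)) + C * q powr m * q ^ t * g"
      using norm_triangle_sub[of "G z w" "w * (1 + X)"] G[of z w] q w
      by (simp add: X_def q_def g_def algebra_simps)
    also have "norm (w * (1 + X)) \<le> q powr m * norm (1 + X)"
      using w by (simp add: norm_mult q_def mult_right_mono)
    also have "q powr m * norm (1 + X) + C * q powr m * q ^ t * g
        = q powr m * (norm (1 + X) + C * (q ^ t * g))"
      by (simp add: algebra_simps)
    also have "\<dots> < q powr m * exp (m * Re L)"
    proof (rule mult_strict_left_mono)
      show "norm (1 + X) + C * (q ^ t * g) < exp (m * Re L)"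
        using X_le key exp_ge_add_one_self[of "m * Re L"] by linarith
    qed (use q in simp)
    also have "\<dots> = norm (F z w) powr m"
      using q by (simp add: norm_F powr_mult powr_def[of "exp _"])
    finally have "norm (G z w) < norm (F z w) powr m" by simp
    with 1 2 show ?thesis by (simp add: q_def)
  qed
  show thesis
  proof (rule that)
    show "0 < \<phi>" "0 < \<delta>" "\<delta> \<le> \<delta>0" "0 < A / 4" by fact+ (use \<open>A > 0\<close> in simp)
    show "\<phi> < pi" using \<phi>_le pi_gt_zero by linarith
  qed (rule main)
qed

section \<open>Homogeneous expansion of a germ\<close>

text \<open>Absolute convergence at the single point (R, R) with R = \<rho>/2 is enough; this point
  lies in the ball since sqrt 2 * R < \<rho>. For |x| \<le> R a monomial of degree n is at most
  (|x|/R)^n times its absolute value at (R, R), and n \<ge> M+1 allows (|x|/R)^(M+1) to be pulled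
  out of the tail.\<close>

lemma power_series_tail_bound:
  fixes d :: "nat \<Rightarrow> nat \<Rightarrow> complex" and F :: "complex \<times> complex \<Rightarrow> complex"
  assumes \<rho>: "0 < \<rho>"
    and F: "\<And>x. norm x < \<rho> \<Longrightarrow> ((\<lambda>(i,j). d i j * fst x ^ i * snd x ^ j) has_sum F x) UNIV"
  obtains C where "0 \<le> C"
    "\<And>x. norm x \<le> \<rho> / 2 \<Longrightarrow>
      norm (F x - (\<Sum>n\<le>M. \<Sum>i\<le>n. d i (n - i) * fst x ^ i * snd x ^ (n - i))) \<le> C * norm x ^ (M + 1)"
proof -
  define R where "R = \<rho> / 2"
  have "R > 0" using \<rho> by (simp add: R_def)
  have "norm (complex_of_real R, complex_of_real R) = sqrt (2 * R\<^sup>2)"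
    by (simp add: norm_Pair)
  also have "\<dots> < sqrt (\<rho>\<^sup>2)"
    unfolding R_def by (rule real_sqrt_less_mono) (use \<rho> in \<open>simp add: power2_eq_square\<close>)
  finally have "norm (complex_of_real R, complex_of_real R) < \<rho>"
    using \<rho> by simp
  from has_sum_imp_summable[OF F[OF this]]
  have "(\<lambda>p. norm ((\<lambda>(i,j). d i j * of_real R ^ i * of_real R ^ j) p)) summable_on UNIV"
    unfolding summable_on_iff_abs_summable_on_complex by simp
  then have summ: "(\<lambda>(i,j). norm (d i j) * R ^ (i + j)) summable_on UNIV"
    using \<open>R > 0\<close> by (simp add: case_prod_unfold norm_mult norm_power power_add mult_ac)
  define S where "S = infsum (\<lambda>(i,j). norm (d i j) * R ^ (i + j)) UNIV"
  have S: "((\<lambda>(i,j). norm (d i j) * R ^ (i + j)) has_sum S) UNIV"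
    unfolding S_def using summ by (rule has_sum_infsum)
  have "S \<ge> 0"
    unfolding S_def using \<open>R > 0\<close> by (intro infsum_nonneg) auto
  define T where "T = {(i::nat, j). i + j \<le> M}"
  have "T \<subseteq> {..M} \<times> {..M}" by (auto simp: T_def)
  then have "finite T" by (rule finite_subset) auto
  have "norm (F x - (\<Sum>n\<le>M. \<Sum>i\<le>n. d i (n - i) * fst x ^ i * snd x ^ (n - i)))
      \<le> S / R ^ (M + 1) * norm x ^ (M + 1)" if x: "norm x \<le> \<rho> / 2" for x
  proof -
    let ?f = "\<lambda>(i,j). d i j * fst x ^ i * snd x ^ j"
    define y where "y = norm x / R"
    have y: "0 \<le> y" "y \<le> 1"
      using x \<open>R > 0\<close> by (auto simp: y_def R_def)
    have comp: "norm (fst x) \<le> norm x" "norm (snd x) \<le> norm x"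
      using norm_fst_le[of "fst x" "snd x"] norm_snd_le[of "snd x" "fst x"] by simp_all
    have nx: "norm x = y * R" using \<open>R > 0\<close> by (simp add: y_def)
    have fx: "(?f has_sum F x) UNIV"
      using x \<rho> by (intro F) auto
    have "(?f has_sum (F x - sum ?f T)) (UNIV - T)"
      using fx \<open>finite T\<close> by (intro has_sum_Diff has_sum_finite) auto
    moreover have "sum ?f T = (\<Sum>n\<le>M. \<Sum>i\<le>n. d i (n - i) * fst x ^ i * snd x ^ (n - i))"
      unfolding T_def by (rule sum.triangle_reindex_eq)
    ultimately have *: "(?f has_sum (F x - (\<Sum>n\<le>M. \<Sum>i\<le>n. d i (n - i) * fst x ^ i * snd x ^ (n - i)))) (UNIV - T)"
      by simp
    have "(\<lambda>p. norm (?f p)) summable_on UNIV"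
      using has_sum_imp_summable[OF fx] unfolding summable_on_iff_abs_summable_on_complex .
    then have f_abs: "(\<lambda>p. norm (?f p)) summable_on (UNIV - T)"
      by (rule summable_on_subset_banach) auto
    have "norm (F x - (\<Sum>n\<le>M. \<Sum>i\<le>n. d i (n - i) * fst x ^ i * snd x ^ (n - i)))
        \<le> infsum (\<lambda>p. norm (?f p)) (UNIV - T)"
      using norm_infsum_bound[OF f_abs] infsumI[OF *] by simp
    also have "\<dots> \<le> y ^ (M + 1) * S"
    proof (rule has_sum_mono_neutral[OF has_sum_infsum[OF f_abs] has_sum_cmult_right[OF S]])
      fix p assume p: "p \<in> (UNIV - T) \<inter> UNIV"
      obtain i j where ij: "p = (i, j)" by (cases p)
      then have "M + 1 \<le> i + j" using p by (auto simp: T_def)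
      have "norm (?f p) = norm (d i j) * (norm (fst x) ^ i * norm (snd x) ^ j)"
        by (simp add: ij norm_mult norm_power)
      also have "\<dots> \<le> norm (d i j) * (norm x ^ i * norm x ^ j)"
        by (intro mult_left_mono mult_mono power_mono comp) auto
      also have "\<dots> = norm (d i j) * R ^ (i + j) * y ^ (i + j)"
        by (simp add: nx power_mult_distrib power_add mult_ac)
      also have "\<dots> \<le> norm (d i j) * R ^ (i + j) * y ^ (M + 1)"
        using y \<open>R > 0\<close> \<open>M + 1 \<le> i + j\<close> by (intro mult_left_mono power_decreasing) auto
      finally show "norm (?f p) \<le> y ^ (M + 1) * (case p of (i,j) \<Rightarrow> norm (d i j) * R ^ (i + j))"
        by (simp add: ij mult_ac)
    qed (use y \<open>R > 0\<close> in auto)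
    also have "\<dots> = S / R ^ (M + 1) * norm x ^ (M + 1)"
      using \<open>R > 0\<close> by (simp add: y_def power_divide)
    finally show ?thesis .
  qed
  then show thesis
    using \<open>S \<ge> 0\<close> \<open>R > 0\<close> by (intro that[of "S / R ^ (M + 1)"]) auto
qed

lemma cmul_simps [simp]: "fst (cmul l x) = l * fst x" "snd (cmul l x) = l * snd x"
  by (simp_all add: cmul_def)

lemma norm_cmul: "norm (cmul l x) = norm l * norm x"
  by (simp add: norm_prod_def norm_mult power_mult_distrib distrib_left[symmetric] real_sqrt_mult)

lemma hpart_cmul: "hpart c j (cmul z x) = cmul (z ^ j) (hpart c j x)"
proof -
  have "d * (z * fst x) ^ i * (z * snd x) ^ (j - i) = z ^ j * (d * fst x ^ i * snd x ^ (j - i))"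
    if "i \<le> j" for d i
  proof -
    have "z ^ j = z ^ i * z ^ (j - i)"
      using that by (simp flip: power_add)
    then show ?thesis by (simp add: power_mult_distrib)
  qed
  then show ?thesis
    by (auto simp: hpart_def cmul_def sum_distrib_left mult.assoc intro!: sum.cong)
qed

lemma holo_germ_series_tail_bound:
  assumes germ: "holo_germ_series f p \<rho> c"
  obtains C where "0 \<le> C"
    "\<And>x. norm x \<le> \<rho> / 2 \<Longrightarrow> norm (f (p + x) - (\<Sum>n\<le>M. hpart c n x)) \<le> C * norm x ^ (M + 1)"
proof -
  have "0 < \<rho>" using germ by (simp add: holo_germ_series_def)
  have
    "((\<lambda>(i,j). fst (c i j) * fst x ^ i * snd x ^ j) has_sum fst (f (p + x))) UNIV"
    "((\<lambda>(i,j). snd (c i j) * fst x ^ i * snd x ^ j) has_sum snd (f (p + x))) UNIV"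
    if "norm x < \<rho>" for x
    using germ that by (auto simp: holo_germ_series_def)
  note F = this
  obtain C1 where C1: "0 \<le> C1" "\<And>x. norm x \<le> \<rho> / 2 \<Longrightarrow> norm (fst (f (p + x)) -
        (\<Sum>n\<le>M. \<Sum>i\<le>n. fst (c i (n - i)) * fst x ^ i * snd x ^ (n - i))) \<le> C1 * norm x ^ (M + 1)"
    by (rule power_series_tail_bound[OF \<open>0 < \<rho>\<close> F(1), of M]) (assumption, rule that)
  obtain C2 where C2: "0 \<le> C2" "\<And>x. norm x \<le> \<rho> / 2 \<Longrightarrow> norm (snd (f (p + x)) -
        (\<Sum>n\<le>M. \<Sum>i\<le>n. snd (c i (n - i)) * fst x ^ i * snd x ^ (n - i))) \<le> C2 * norm x ^ (M + 1)"
    by (rule power_series_tail_bound[OF \<open>0 < \<rho>\<close> F(2), of M]) (assumption, rule that)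
  show thesis
  proof (rule that[of "C1 + C2"])
    fix x :: "complex \<times> complex" assume x: "norm x \<le> \<rho> / 2"
    define y where "y = f (p + x) - (\<Sum>n\<le>M. hpart c n x)"
    have "norm y \<le> norm (fst y) + norm (snd y)"
      using norm_Pair_le[of "fst y" "snd y"] by simp
    also have "norm (fst y) \<le> C1 * norm x ^ (M + 1)"
      using C1(2)[OF x] by (simp add: y_def fst_sum hpart_def)
    also have "norm (snd y) \<le> C2 * norm x ^ (M + 1)"
      using C2(2)[OF x] by (simp add: y_def snd_sum hpart_def)
    finally show "norm (f (p + x) - (\<Sum>n\<le>M. hpart c n x)) \<le> (C1 + C2) * norm x ^ (M + 1)"
      by (simp add: y_def algebra_simps)
  qed (use C1 C2 in simp)
qed

lemma hpart_0_eq: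
  assumes germ: "holo_germ_series f p \<rho> c"
  shows "hpart c 0 x = f p"
proof -
  obtain C where "\<And>x. norm x \<le> \<rho> / 2 \<Longrightarrow> norm (f (p + x) - (\<Sum>n\<le>0. hpart c n x)) \<le> C * norm x ^ (0 + 1)"
    using holo_germ_series_tail_bound[OF germ, of 0] by blast
  from this[of 0] have "f p = hpart c 0 0"
    using germ by (simp add: holo_germ_series_def)
  then show ?thesis by (simp add: hpart_def)
qed

text \<open>The tail bound for M = 1 makes \<open>hpart c 1\<close> a derivative of \<open>f\<close>
  at \<open>p\<close>, and derivatives are unique. This links the coefficients to tangency, which is
  assumed only in terms of \<open>has_derivative\<close>.\<close>

lemma hpart_1_eq:
  assumes germ: "holo_germ_series f p \<rho> c" and D: "(f has_derivative D) (at p)"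
  shows "hpart c 1 = D"
proof -
  have "0 < \<rho>" using germ by (simp add: holo_germ_series_def)
  obtain C where C: "0 \<le> C"
    "\<And>x. norm x \<le> \<rho> / 2 \<Longrightarrow> norm (f (p + x) - (\<Sum>n\<le>1. hpart c n x)) \<le> C * norm x ^ (1 + 1)"
    using holo_germ_series_tail_bound[OF germ, of 1] by blast
  have "linear (hpart c 1)"
    by (rule linearI) (auto simp: hpart_def algebra_simps scaleR_prod_def)
  then have "bounded_linear (hpart c 1)"
    by (simp add: linear_conv_bounded_linear)
  moreover have "((\<lambda>h. norm (f (p + h) - f p - hpart c 1 h) / norm h) \<longlongrightarrow> 0) (at 0)"
  proof (rule Lim_null_comparison)
    have "\<forall>\<^sub>F h in at 0. norm h \<le> \<rho> / 2"
      unfolding eventually_at using \<open>0 < \<rho>\<close>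
      by (intro exI[of _ "\<rho> / 2"]) (auto simp: dist_norm)
    then show "\<forall>\<^sub>F h in at 0. norm (norm (f (p + h) - f p - hpart c 1 h) / norm h) \<le> C * norm h"
    proof eventually_elim
      case (elim h)
      have "norm (f (p + h) - f p - hpart c 1 h) \<le> C * norm h * norm h"
        using C(2)[OF elim] hpart_0_eq[OF germ] by (simp add: power2_eq_square diff_diff_eq mult.assoc)
      then show ?case
        using C(1) by (cases "h = 0") (auto simp: field_simps)
    qed
    show "((\<lambda>h. C * norm h) \<longlongrightarrow> 0) (at (0 :: complex \<times> complex))"
      by (rule tendsto_mult_right_zero) (rule tendsto_norm_zero[OF tendsto_ident_at])
  qed
  ultimately have "(f has_derivative hpart c 1) (at p)"
    by (simp add: has_derivative_at)
  then show ?thesis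
    using D by (rule has_derivative_unique)
qed

text \<open>The parameter u will be w/z. Polynomials in u can be split as P(0) + u Q(u), from which
  the Taylor bounds below follow; \<open>A\<close> and \<open>B\<close> let one statement serve both
  coordinate functionals.\<close>

lemma hpart_line_poly:
  obtains P where "\<And>u. A * fst (hpart c j (v + cmul u w)) + B * snd (hpart c j (v + cmul u w)) = poly P u"
proof
  fix u
  let ?x = "[:fst v, fst w:]" and ?y = "[:snd v, snd w:]"
  show "A * fst (hpart c j (v + cmul u w)) + B * snd (hpart c j (v + cmul u w)) =
      poly (smult A (\<Sum>i\<le>j. smult (fst (c i (j - i))) (?x ^ i * ?y ^ (j - i))) +
            smult B (\<Sum>i\<le>j. smult (snd (c i (j - i))) (?x ^ i * ?y ^ (j - i)))) u"
    by (simp add: hpart_def poly_sum poly_power poly_mult mult.assoc del: mult_pCons_left mult_pCons_right)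
qed

section \<open>Taylor bounds at 0 for polynomials on the unit disc\<close>

lemma poly_bounded_unit_disc:
  fixes P :: "complex poly"
  obtains C where "0 \<le> C" "\<And>u. norm u \<le> 1 \<Longrightarrow> norm (poly P u) \<le> C"
proof -
  have "compact (poly P ` cball 0 1)"
    by (intro compact_continuous_image continuous_intros) auto
  then have "bounded (poly P ` cball 0 1)"
    by (rule compact_imp_bounded)
  then obtain C where C: "\<forall>y\<in>poly P ` cball 0 1. norm y \<le> C"
    unfolding bounded_iff ..
  have *: "norm (poly P u) \<le> C" if "norm u \<le> 1" for u
    using C that by simp
  have "norm (poly P 0) \<le> C" by (rule *) simp
  then have "0 \<le> C"
    using norm_ge_zero[of "poly P 0"] by linarith
  then show thesis using * by (rule that)
qed

lemma poly_linear_bound: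
  fixes P :: "complex poly"
  obtains C where "0 \<le> C" "\<And>u. norm u \<le> 1 \<Longrightarrow> norm (poly P u - poly P 0) \<le> C * norm u"
proof -
  obtain a Q where P: "P = pCons a Q" by (cases P)
  obtain C where C: "0 \<le> C" "\<And>u. norm u \<le> 1 \<Longrightarrow> norm (poly Q u) \<le> C"
    using poly_bounded_unit_disc by blast
  show thesis
  proof (rule that[OF C(1)])
    fix u :: complex assume "norm u \<le> 1"
    then show "norm (poly P u - poly P 0) \<le> C * norm u"
      using mult_left_mono[OF C(2), of u "norm u"] by (simp add: P norm_mult mult.commute)
  qed
qed

lemma poly_quadratic_bound:
  fixes P :: "complex poly"
  obtains C where "0 \<le> C"
    "\<And>u. norm u \<le> 1 \<Longrightarrow> norm (poly P u - poly P 0 - deriv (poly P) 0 * u) \<le> C * norm u ^ 2"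
proof -
  obtain a Q where P: "P = pCons a Q" by (cases P)
  obtain C where C: "0 \<le> C" "\<And>u. norm u \<le> 1 \<Longrightarrow> norm (poly Q u - poly Q 0) \<le> C * norm u"
    using poly_linear_bound by blast
  have d: "deriv (poly P) 0 = poly Q 0"
  proof -
    have "poly (pderiv P) 0 = poly Q 0" by (simp add: P pderiv_pCons)
    then show ?thesis using DERIV_imp_deriv[OF poly_DERIV[of P 0]] by (rule trans[rotated])
  qed
  have "norm (poly P u - poly P 0 - deriv (poly P) 0 * u) \<le> C * norm u ^ 2" if "norm u \<le> 1" for u
  proof -
    have "poly P u - poly P 0 - deriv (poly P) 0 * u = u * (poly Q u - poly Q 0)"
      unfolding d by (simp add: P algebra_simps)
    then show ?thesis
      using mult_left_mono[OF C(2)[OF that], of "norm u"]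
      by (simp add: norm_mult power2_eq_square mult_ac)
  qed
  then show thesis using C(1) that by blast
qed

lemma norm_sum_bound_termwise:
  fixes T :: "'j \<Rightarrow> 'x \<Rightarrow> 'a :: real_normed_vector" and E :: "'x \<Rightarrow> real"
  assumes "\<And>j. j \<in> J \<Longrightarrow> \<exists>C\<ge>0. \<forall>x\<in>X. norm (T j x) \<le> C * E x"
  obtains C where "0 \<le> C" "\<And>x. x \<in> X \<Longrightarrow> norm (\<Sum>j\<in>J. T j x) \<le> C * E x"
proof -
  obtain C where C: "\<And>j. j \<in> J \<Longrightarrow> 0 \<le> C j"
      "\<And>j x. j \<in> J \<Longrightarrow> x \<in> X \<Longrightarrow> norm (T j x) \<le> C j * E x"
    using assms by metis
  show thesis
  proof (rule that[of "\<Sum>j\<in>J. C j"])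
    show "0 \<le> (\<Sum>j\<in>J. C j)" by (rule sum_nonneg) (rule C)
    show "norm (\<Sum>j\<in>J. T j x) \<le> (\<Sum>j\<in>J. C j) * E x" if "x \<in> X" for x
      unfolding sum_distrib_right using C(2) that by (intro sum_norm_le) auto
  qed
qed

text \<open>By homogeneity P_j(z v + w w0) = z^j P_j(v + (w/z) w0), so each degree contributes a
  polynomial in w/z. The condition |w| \<le> |z| keeps w/z in the unit disc and makes |z v + w w0| =
  O(|z|), hence the tail O(|z|^(M+1)).\<close>

lemma tangent_germ_expansion:
  fixes A B :: complex
  defines "l \<equiv> (\<lambda>y. A * fst y + B * snd y)"
  assumes germ: "holo_germ_series f p \<rho> c" and fixed: "f p = p"
    and tangent: "(f has_derivative id) (at p)"
    and k: "1 \<le> k" "k \<le> M" and order: "\<forall>j. 2 \<le> j \<and> j \<le> k \<longrightarrow> (\<forall>x. hpart c j x = 0)"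
  obtains C \<delta> where "0 \<le> C" "0 < \<delta>" "\<delta> < 1"
    "\<And>z w. \<lbrakk>0 < norm z; norm z < \<delta>; norm w \<le> norm z\<rbrakk> \<Longrightarrow>
      norm (l (f (p + (cmul z v + cmul w w0)) - p) - (l (cmul z v + cmul w w0) +
        (\<Sum>j\<in>{k+1..M}. z ^ j * l (hpart c j (v + cmul (w / z) w0))))) \<le> C * norm z ^ (M + 1)"
proof -
  have "0 < \<rho>" using germ by (simp add: holo_germ_series_def)
  obtain C where C: "0 \<le> C"
    "\<And>x. norm x \<le> \<rho> / 2 \<Longrightarrow> norm (f (p + x) - (\<Sum>n\<le>M. hpart c n x)) \<le> C * norm x ^ (M + 1)"
    using holo_germ_series_tail_bound[OF germ, of M] by blast
  define N where "N = norm v + norm w0 + 1"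
  have "N > 0" by (simp add: N_def add_nonneg_pos)
  define \<delta> where "\<delta> = min (1 / 2) (\<rho> / 2 / N)"
  have split: "(\<Sum>n\<le>M. hpart c n x) = p + x + (\<Sum>j\<in>{k+1..M}. hpart c j x)" for x
  proof -
    \<comment> \<open>Degrees 0 and 1 give p + x by the fixed point and tangency; degrees 2 to k
      vanish by the order of the germ.\<close>
    have M: "{..M} = {0, 1} \<union> ({2..k} \<union> {k+1..M})"
      using k by auto
    have "(\<Sum>n\<le>M. hpart c n x) = (\<Sum>n\<in>{0, 1}. hpart c n x) + (\<Sum>n\<in>{2..k} \<union> {k+1..M}. hpart c n x)"
      unfolding M by (rule sum.union_disjoint) (use k in auto)
    moreover have "(\<Sum>n\<in>{2..k} \<union> {k+1..M}. hpart c n x) = (\<Sum>n\<in>{2..k}. hpart c n x) + (\<Sum>n\<in>{k+1..M}. hpart c n x)"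
      by (rule sum.union_disjoint) auto
    moreover have "(\<Sum>n\<in>{2..k}. hpart c n x) = 0"
    proof (rule sum.neutral, rule ballI)
      fix n assume "n \<in> {2..k}"
      then have "2 \<le> n \<and> n \<le> k" by simp
      then show "hpart c n x = 0" using order by blast
    qed
    moreover have "(\<Sum>n\<in>{0, 1}. hpart c n x) = p + x"
      using hpart_0_eq[OF germ, of x] fixed fun_cong[OF hpart_1_eq[OF germ tangent], of x] by simp
    ultimately show ?thesis by simp
  qed
  have l_diff: "l (x - y) = l x - l y" for x y
    by (simp add: l_def algebra_simps)
  have l_add: "l (x + y) = l x + l y" for x y
    by (simp add: l_def algebra_simps)
  have l_cmul: "l (cmul z x) = z * l x" for z x
    by (simp add: l_def algebra_simps)
  have l_sum: "l (sum g S) = (\<Sum>i\<in>S. l (g i))" for g and S :: "nat set"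
    by (simp add: l_def fst_sum snd_sum sum_distrib_left sum.distrib)
  have l_norm: "norm (l x) \<le> (norm A + norm B) * norm x" for x
  proof -
    have "norm (l x) \<le> norm A * norm (fst x) + norm B * norm (snd x)"
      unfolding l_def using norm_triangle_ineq[of "A * fst x" "B * snd x"] by (simp add: norm_mult)
    also have "\<dots> \<le> norm A * norm x + norm B * norm x"
      using norm_fst_le[of "fst x" "snd x"] norm_snd_le[of "snd x" "fst x"]
      by (intro add_mono mult_left_mono) auto
    finally show ?thesis by (simp add: algebra_simps)
  qed
  show thesis
  proof (rule that[of "(norm A + norm B) * (C * N ^ (M + 1))" \<delta>])
    show "0 < \<delta>" "\<delta> < 1"
      using \<open>0 < \<rho>\<close> \<open>N > 0\<close> by (simp_all add: \<delta>_def)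
    show "0 \<le> (norm A + norm B) * (C * N ^ (M + 1))"
      using \<open>N > 0\<close> C(1) by (intro mult_nonneg_nonneg) auto
    fix z w :: complex assume z: "0 < norm z" "norm z < \<delta>" and w: "norm w \<le> norm z"
    define x where "x = cmul z v + cmul w w0"
    have x_eq: "x = cmul z (v + cmul (w / z) w0)"
    proof -
      have "z \<noteq> 0" using z(1) by simp
      then show ?thesis by (simp add: x_def prod_eq_iff distrib_left)
    qed
    have "norm x \<le> norm z * norm v + norm w * norm w0"
      unfolding x_def using norm_triangle_ineq[of "cmul z v" "cmul w w0"] by (simp add: norm_cmul)
    also have "\<dots> \<le> norm z * norm v + norm z * norm w0"
      using w by (intro add_mono mult_right_mono) auto
    also have "\<dots> \<le> norm z * N"
      by (simp add: N_def algebra_simps)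
    finally have nx: "norm x \<le> norm z * N" .
    also have "norm z * N \<le> \<rho> / 2 / N * N"
      using z \<open>N > 0\<close> by (intro mult_right_mono) (auto simp: \<delta>_def)
    finally have "norm x \<le> \<rho> / 2" using \<open>N > 0\<close> by simp
    note * = C(2)[OF this, unfolded split]
    have "l (f (p + x) - p) - (l x + (\<Sum>j\<in>{k+1..M}. z ^ j * l (hpart c j (v + cmul (w / z) w0))))
        = l (f (p + x) - (p + x + (\<Sum>j\<in>{k+1..M}. hpart c j x)))"
      by (simp add: l_diff l_add l_sum x_eq hpart_cmul l_cmul)
    also have "norm \<dots> \<le> (norm A + norm B) * (C * norm x ^ (M + 1))"
      by (rule order_trans[OF l_norm]) (intro mult_left_mono *, simp)
    also have "\<dots> \<le> (norm A + norm B) * (C * (norm z * N) ^ (M + 1))"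
      using nx C(1) by (intro mult_left_mono power_mono) auto
    finally show "norm (l (f (p + (cmul z v + cmul w w0)) - p) - (l (cmul z v + cmul w w0) +
        (\<Sum>j\<in>{k+1..M}. z ^ j * l (hpart c j (v + cmul (w / z) w0)))))
        \<le> (norm A + norm B) * (C * N ^ (M + 1)) * norm z ^ (M + 1)"
      by (simp add: x_def power_mult_distrib mult_ac)
  qed
qed

section \<open>Estimates along a characteristic direction\<close>

text \<open>Common frame for both coordinates: \<open>main\<close> is the explicit term kept in each
  degree, \<open>E\<close> the size against which errors are measured. What remains for each degree
  is one claim about a polynomial in w/z.\<close>

lemma tangent_germ_estimate:
  fixes A B :: complex and E :: "complex \<Rightarrow> complex \<Rightarrow> real"
    and main :: "nat \<Rightarrow> complex \<Rightarrow> complex \<Rightarrow> complex"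
  defines "l \<equiv> (\<lambda>y. A * fst y + B * snd y)"
  assumes germ: "holo_germ_series f p \<rho> c" and fixed: "f p = p"
    and tangent: "(f has_derivative id) (at p)"
    and k: "1 \<le> k" "k \<le> M" and order: "\<forall>j. 2 \<le> j \<and> j \<le> k \<longrightarrow> (\<forall>x. hpart c j x = 0)"
    and terms: "\<And>j P. \<lbrakk>j \<in> {k+1..M}; \<And>u. l (hpart c j (v + cmul u w0)) = poly P u\<rbrakk> \<Longrightarrow>
      \<exists>C\<ge>0. \<forall>z w. 0 < norm z \<longrightarrow> norm z < 1 \<longrightarrow> norm w \<le> norm z \<longrightarrow>
        norm (z ^ j * poly P (w / z) - main j z w) \<le> C * E z w"
    and rest: "\<And>z w. \<lbrakk>0 < norm z; norm z < 1; norm w \<le> norm z\<rbrakk> \<Longrightarrow> norm z ^ (M + 1) \<le> E z w"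
  obtains C \<delta> where "0 \<le> C" "0 < \<delta>" "\<delta> < 1"
    "\<And>z w. \<lbrakk>0 < norm z; norm z < \<delta>; norm w \<le> norm z\<rbrakk> \<Longrightarrow>
      norm (l (f (p + (cmul z v + cmul w w0)) - p) -
        (l (cmul z v + cmul w w0) + (\<Sum>j\<in>{k+1..M}. main j z w))) \<le> C * E z w"
proof -
  obtain C1 \<delta> where C1: "0 \<le> C1" "0 < \<delta>" "\<delta> < 1"
    "\<And>z w. \<lbrakk>0 < norm z; norm z < \<delta>; norm w \<le> norm z\<rbrakk> \<Longrightarrow>
      norm (l (f (p + (cmul z v + cmul w w0)) - p) - (l (cmul z v + cmul w w0) +
        (\<Sum>j\<in>{k+1..M}. z ^ j * l (hpart c j (v + cmul (w / z) w0))))) \<le> C1 * norm z ^ (M + 1)"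
    unfolding l_def by (rule tangent_germ_expansion[where A = A and B = B and v = v and ?w0.0 = w0, OF germ fixed tangent k order])
      (rule that[unfolded l_def])
  define X :: "(complex \<times> complex) set" where "X = {(z, w). 0 < norm z \<and> norm z < 1 \<and> norm w \<le> norm z}"
  define T where "T j = (\<lambda>(z, w). z ^ j * l (hpart c j (v + cmul (w / z) w0)) - main j z w)" for j
  have "\<exists>C\<ge>0. \<forall>x\<in>X. norm (T j x) \<le> C * (case x of (z, w) \<Rightarrow> E z w)" if j: "j \<in> {k+1..M}" for j
  proof -
    obtain P where P: "\<And>u. A * fst (hpart c j (v + cmul u w0)) + B * snd (hpart c j (v + cmul u w0)) = poly P u"
      using hpart_line_poly by blast
    obtain C where "C \<ge> 0" "\<forall>z w. 0 < norm z \<longrightarrow> norm z < 1 \<longrightarrow> norm w \<le> norm z \<longrightarrow>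
        norm (z ^ j * poly P (w / z) - main j z w) \<le> C * E z w"
      using terms[OF j, of P] P unfolding l_def by blast
    then show ?thesis
      by (intro exI[of _ C]) (simp add: X_def T_def l_def P split_beta)
  qed
  note bound = this
  obtain C2 where C2: "0 \<le> C2"
    "\<And>x. x \<in> X \<Longrightarrow> norm (\<Sum>j\<in>{k+1..M}. T j x) \<le> C2 * (case x of (z, w) \<Rightarrow> E z w)"
    by (rule norm_sum_bound_termwise[where J = "{k+1..M}" and T = T and X = X, OF bound]) (assumption, rule that)
  show thesis
  proof (rule that[of "C1 + C2" \<delta>])
    fix z w :: complex assume z: "0 < norm z" "norm z < \<delta>" and w: "norm w \<le> norm z"
    let ?d = "l (f (p + (cmul z v + cmul w w0)) - p) - l (cmul z v + cmul w w0)"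
    let ?S = "\<Sum>j\<in>{k+1..M}. z ^ j * l (hpart c j (v + cmul (w / z) w0))"
    let ?m = "\<Sum>j\<in>{k+1..M}. main j z w"
    have "norm (?d - ?S) \<le> C1 * E z w"
      using C1(4)[OF z w] mult_left_mono[OF rest[OF z(1) _ w] C1(1)] z C1(3) by (simp add: diff_diff_eq)
    moreover have "norm (?S - ?m) \<le> C2 * E z w"
      using C2(2)[of "(z, w)"] z C1(3) w by (simp add: X_def T_def sum_subtractf)
    ultimately have "norm (?d - ?m) \<le> (C1 + C2) * E z w"
      unfolding distrib_right by (rule norm_diff_triangle_le)
    then show "norm (l (f (p + (cmul z v + cmul w w0)) - p) - (l (cmul z v + cmul w w0) + ?m)) \<le> (C1 + C2) * E z w"
      by (simp add: diff_diff_eq)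
  qed (use C1 C2 in simp_all)
qed

text \<open>Cramer's rule in the basis v, w.\<close>

lemma cdet_cmul_expand:
  assumes "cdet v w \<noteq> 0"
  shows "x = cmul (cdet x w / cdet v w) v + cmul (cdet v x / cdet v w) w"
proof -
  have "cdet v w * fst x = cdet x w * fst v + cdet v x * fst w"
    "cdet v w * snd x = cdet x w * snd v + cdet v x * snd w"
    by (simp_all add: cdet_def algebra_simps)
  then show ?thesis
    using assms by (simp add: prod_eq_iff field_simps)
qed

lemma cdet_cmul_add:
  "cdet (cmul z v + cmul w w0) w0 = z * cdet v w0" "cdet v (cmul z v + cmul w w0) = w * cdet v w0"
  by (simp_all add: cdet_def algebra_simps)

text \<open>Each hypothesis fixes Taylor coefficients in u = w/z. First component: the constant
  coefficient vanishes for j \<le> r and is a for j = r+1, a linear remainder costs |w||z|^(j-1),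
  and degrees above r+1 cost |z|^(r+2). Second component: all constant coefficients up to degree
  r+t-k+1 vanish, the linear one vanishes for j \<le> t and is b for j = t+1; remainders cost |w|^2
  |z|^(j-2) up to degree t+1 and |w||z|^(j-1) beyond.\<close>

lemma char_germ_estimates:
  assumes germ: "holo_germ_series f p \<rho> c" and fixed: "f p = p"
    and tangent: "(f has_derivative id) (at p)"
    and k: "1 \<le> k" and order: "\<forall>j. 2 \<le> j \<and> j \<le> k \<longrightarrow> (\<forall>x. hpart c j x = 0)"
    and coords: "cdet v w0 \<noteq> 0" and t: "k \<le> t" "t \<le> r"
    and degenerate: "\<And>j. k + 1 \<le> j \<Longrightarrow> j \<le> r \<Longrightarrow> hpart c j v = 0"
    and a: "hpart c (r + 1) v = cmul a v"
    and char: "\<And>j. k + 1 \<le> j \<Longrightarrow> j \<le> r + t - k + 1 \<Longrightarrow> cdet v (hpart c j v) = 0"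
    and order1: "\<And>j. k + 1 \<le> j \<Longrightarrow> j \<le> t \<Longrightarrow> deriv (qfun c v w0 j) 0 = 0"
  defines "F \<equiv> \<lambda>z w. cdet (f (p + (cmul z v + cmul w w0)) - p) w0 / cdet v w0"
    and "G \<equiv> \<lambda>z w. cdet v (f (p + (cmul z v + cmul w w0)) - p) / cdet v w0"
    and "b \<equiv> deriv (qfun c v w0 (t + 1)) 0"
  obtains C \<delta> where "0 \<le> C" "0 < \<delta>" "\<delta> < 1"
    "\<And>z w. \<lbrakk>0 < norm z; norm z < \<delta>; norm w \<le> norm z\<rbrakk> \<Longrightarrow>
      norm (F z w - (z + a * z ^ (r + 1))) \<le> C * (norm z ^ (r + 2) + norm w * norm z ^ k)"
    "\<And>z w. \<lbrakk>0 < norm z; norm z < \<delta>; norm w \<le> norm z\<rbrakk> \<Longrightarrow>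
      norm (G z w - (w + b * w * z ^ t)) \<le>
        C * (norm w * norm z ^ (t + 1) + norm w ^ 2 * norm z ^ (k - 1) + norm z ^ (r + t - k + 2))"
proof -
  \<comment> \<open>The last degree covered by \<open>char\<close>; the tail beyond it is the pure
    power of z in the estimate of \<open>G\<close>. As k \<le> t \<le> r, it also reaches the
    degrees r+1 and t+1 of the main terms.\<close>
  define M where "M = r + t - k + 1"
  have M: "k \<le> M" "r + 1 \<le> M" "t + 1 \<le> M" using t by (auto simp: M_def)
  have u1: "norm (w / z) \<le> 1" if "norm w \<le> norm z" for w z :: complex
    using that by (cases "z = 0") (auto simp: norm_divide)
  have zj: "norm z ^ j * norm (w / z) = norm w * norm z ^ (j - 1)" if "0 < norm z" "1 \<le> j" for z w :: complex and j
    using that by (cases j) (auto simp: norm_divide)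
  have zj2: "norm z ^ j * norm (w / z) ^ 2 = norm w ^ 2 * norm z ^ (j - 2)" if "0 < norm z" "2 \<le> j" for z w :: complex and j
  proof -
    have "norm z ^ j = norm z ^ 2 * norm z ^ (j - 2)" using that by (metis le_add_diff_inverse power_add)
    then show ?thesis using that by (simp add: norm_divide power_divide)
  qed
  have decr: "norm z ^ j \<le> norm z ^ i" if "i \<le> j" "norm z < 1" for z :: complex and i j
    using that by (intro power_decreasing) auto

  have l1: "cdet y w0 / cdet v w0 = snd w0 / cdet v w0 * fst y + (- fst w0 / cdet v w0) * snd y" for y
    by (simp add: cdet_def diff_divide_distrib mult.commute)
  have l2: "cdet v y / cdet v w0 = (- snd v / cdet v w0) * fst y + fst v / cdet v w0 * snd y" for y
    by (simp add: cdet_def diff_divide_distrib)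

  define E1 where "E1 z w = norm z ^ (r + 2) + norm w * norm z ^ k" for z w :: complex
  define main1 where "main1 j z w = (if j = r + 1 then a * z ^ (r + 1) else 0)" for j and z w :: complex
  have terms1: "\<exists>C\<ge>0. \<forall>z w. 0 < norm z \<longrightarrow> norm z < 1 \<longrightarrow> norm w \<le> norm z \<longrightarrow>
        norm (z ^ j * poly P (w / z) - main1 j z w) \<le> C * E1 z w"
    if j: "j \<in> {k+1..M}" and P: "\<And>u. cdet (hpart c j (v + cmul u w0)) w0 / cdet v w0 = poly P u" for j P
  proof (cases "j \<le> r + 1")
    case True
    have "poly P 0 = cdet (hpart c j v) w0 / cdet v w0"
      unfolding P[symmetric] by (simp add: cmul_def flip: zero_prod_def)
    also have "\<dots> = (if j = r + 1 then a else 0)"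
    proof (cases "j = r + 1")
      case True
      have "cdet (cmul a v) w0 = a * cdet v w0"
        by (simp add: cdet_def algebra_simps)
      then show ?thesis using True a coords by simp
    qed (use True degenerate[of j] j in \<open>simp add: cdet_def\<close>)
    finally have P0: "main1 j z w = z ^ j * poly P 0" for z w
      by (simp add: main1_def)
    obtain C where C: "0 \<le> C" "\<And>u. norm u \<le> 1 \<Longrightarrow> norm (poly P u - poly P 0) \<le> C * norm u"
      using poly_linear_bound by blast
    have "norm (z ^ j * poly P (w / z) - main1 j z w) \<le> C * E1 z w"
      if z: "0 < norm z" "norm z < 1" and w: "norm w \<le> norm z" for z w
    proof -
      have "norm (z ^ j * poly P (w / z) - main1 j z w) = norm z ^ j * norm (poly P (w / z) - poly P 0)"
        unfolding P0 right_diff_distrib[symmetric] by (simp add: norm_mult norm_power)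
      also have "\<dots> \<le> norm z ^ j * (C * norm (w / z))"
        by (intro mult_left_mono C(2) u1 w) auto
      also have "\<dots> = C * (norm w * norm z ^ (j - 1))"
        using zj[OF z(1), of j w] j by (simp add: mult.left_commute)
      also have "\<dots> \<le> C * E1 z w"
        unfolding E1_def using decr[of k "j - 1" z] z j C(1)
        by (intro mult_left_mono add_increasing) auto
      finally show ?thesis .
    qed
    then show ?thesis using C(1) by blast
  next
    case False
    obtain C where C: "0 \<le> C" "\<And>u. norm u \<le> 1 \<Longrightarrow> norm (poly P u) \<le> C"
      using poly_bounded_unit_disc by blast
    have "norm (z ^ j * poly P (w / z) - main1 j z w) \<le> C * E1 z w"
      if z: "0 < norm z" "norm z < 1" and w: "norm w \<le> norm z" for z w
    proof -
      have "norm (z ^ j * poly P (w / z) - main1 j z w) = norm z ^ j * norm (poly P (w / z))"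
        using False by (simp add: main1_def norm_mult norm_power)
      also have "\<dots> \<le> norm z ^ (r + 2) * C"
        using False z by (intro mult_mono C(2) u1 w decr) auto
      also have "\<dots> \<le> C * E1 z w"
        unfolding E1_def using C(1) by (simp add: mult.commute mult_left_mono)
      finally show ?thesis .
    qed
    then show ?thesis using C(1) by blast
  qed
  have "norm z ^ (M + 1) \<le> E1 z w" if "norm z < 1" for z w
    unfolding E1_def using decr[of "r + 2" "M + 1" z] M that by (intro add_increasing2) auto
  then obtain C1 \<delta>1 where C1: "0 \<le> C1" "0 < \<delta>1" "\<delta>1 < 1"
    "\<And>z w. \<lbrakk>0 < norm z; norm z < \<delta>1; norm w \<le> norm z\<rbrakk> \<Longrightarrow>
      norm (cdet (f (p + (cmul z v + cmul w w0)) - p) w0 / cdet v w0 -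
        (cdet (cmul z v + cmul w w0) w0 / cdet v w0 + (\<Sum>j\<in>{k+1..M}. main1 j z w))) \<le> C1 * E1 z w"
    using tangent_germ_estimate[where A = "snd w0 / cdet v w0" and B = "- fst w0 / cdet v w0" and v = v and ?w0.0 = w0
        and main = main1 and E = E1, OF germ fixed tangent k M(1) order, folded l1] terms1 by blast

  define E2 where "E2 z w =
    norm w * norm z ^ (t + 1) + norm w ^ 2 * norm z ^ (k - 1) + norm z ^ (r + t - k + 2)" for z w :: complex
  define main2 where "main2 j z w = (if j = t + 1 then b * w * z ^ t else 0)" for j and z w :: complex
  have terms2: "\<exists>C\<ge>0. \<forall>z w. 0 < norm z \<longrightarrow> norm z < 1 \<longrightarrow> norm w \<le> norm z \<longrightarrow>
        norm (z ^ j * poly P (w / z) - main2 j z w) \<le> C * E2 z w"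
    if j: "j \<in> {k+1..M}" and P: "\<And>u. cdet v (hpart c j (v + cmul u w0)) / cdet v w0 = poly P u" for j P
  proof -
    have qfun: "qfun c v w0 j = poly P"
      unfolding qfun_def P ..
    have "poly P 0 = cdet v (hpart c j v) / cdet v w0"
      unfolding P[symmetric] by (simp add: cmul_def flip: zero_prod_def)
    then have P0: "poly P 0 = 0"
      using char[of j] j by (simp add: M_def)
    show ?thesis
    proof (cases "j \<le> t + 1")
      case True
      obtain C where C: "0 \<le> C"
        "\<And>u. norm u \<le> 1 \<Longrightarrow> norm (poly P u - poly P 0 - deriv (poly P) 0 * u) \<le> C * norm u ^ 2"
        using poly_quadratic_bound by blast
      have "deriv (poly P) 0 = (if j = t + 1 then b else 0)"
        using order1[of j] True j unfolding qfun[symmetric] b_def by auto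
      then have main2: "main2 j z w = z ^ j * (deriv (poly P) 0 * (w / z))" if "0 < norm z" for z w
        using that by (simp add: main2_def)
      have "norm (z ^ j * poly P (w / z) - main2 j z w) \<le> C * E2 z w"
        if z: "0 < norm z" "norm z < 1" and w: "norm w \<le> norm z" for z w
      proof -
        have "norm (z ^ j * poly P (w / z) - main2 j z w) =
            norm z ^ j * norm (poly P (w / z) - poly P 0 - deriv (poly P) 0 * (w / z))"
          unfolding main2[OF z(1)] right_diff_distrib[symmetric] P0 by (simp add: norm_mult norm_power)
        also have "\<dots> \<le> norm z ^ j * (C * norm (w / z) ^ 2)"
          by (intro mult_left_mono C(2) u1 w) auto
        also have "\<dots> = C * (norm w ^ 2 * norm z ^ (j - 2))"
          using zj2[OF z(1), of j w] j k by (simp add: mult.left_commute)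
        also have "\<dots> \<le> C * (norm w ^ 2 * norm z ^ (k - 1))"
          using decr[of "k - 1" "j - 2" z] z j C(1) by (intro mult_left_mono) auto
        also have "\<dots> \<le> C * E2 z w"
          unfolding E2_def using C(1) by (intro mult_left_mono) auto
        finally show ?thesis .
      qed
      then show ?thesis using C(1) by blast
    next
      case False
      obtain C where C: "0 \<le> C" "\<And>u. norm u \<le> 1 \<Longrightarrow> norm (poly P u - poly P 0) \<le> C * norm u"
        using poly_linear_bound by blast
      have "norm (z ^ j * poly P (w / z) - main2 j z w) \<le> C * E2 z w"
        if z: "0 < norm z" "norm z < 1" and w: "norm w \<le> norm z" for z w
      proof -
        have "norm (z ^ j * poly P (w / z) - main2 j z w) = norm z ^ j * norm (poly P (w / z) - poly P 0)"
          using False by (simp add: main2_def P0 norm_mult norm_power)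
        also have "\<dots> \<le> norm z ^ j * (C * norm (w / z))"
          by (intro mult_left_mono C(2) u1 w) auto
        also have "\<dots> = C * (norm w * norm z ^ (j - 1))"
          using zj[OF z(1), of j w] j by (simp add: mult.left_commute)
        also have "\<dots> \<le> C * (norm w * norm z ^ (t + 1))"
          using decr[of "t + 1" "j - 1" z] z False C(1) by (intro mult_left_mono) auto
        also have "\<dots> \<le> C * E2 z w"
          unfolding E2_def using C(1) by (intro mult_left_mono) auto
        finally show ?thesis .
      qed
      then show ?thesis using C(1) by blast
    qed
  qed
  have "norm z ^ (M + 1) \<le> E2 z w" for z w
    unfolding E2_def M_def by simp
  then obtain C2 \<delta>2 where C2: "0 \<le> C2" "0 < \<delta>2" "\<delta>2 < 1"
    "\<And>z w. \<lbrakk>0 < norm z; norm z < \<delta>2; norm w \<le> norm z\<rbrakk> \<Longrightarrow>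
      norm (cdet v (f (p + (cmul z v + cmul w w0)) - p) / cdet v w0 -
        (cdet v (cmul z v + cmul w w0) / cdet v w0 + (\<Sum>j\<in>{k+1..M}. main2 j z w))) \<le> C2 * E2 z w"
    using tangent_germ_estimate[where A = "- snd v / cdet v w0" and B = "fst v / cdet v w0" and v = v and ?w0.0 = w0
        and main = main2 and E = E2, OF germ fixed tangent k M(1) order, folded l2] terms2 by blast

  have sum1: "(\<Sum>j\<in>{k+1..M}. main1 j z w) = a * z ^ (r + 1)" for z w
    using M t by (simp add: main1_def)
  have sum2: "(\<Sum>j\<in>{k+1..M}. main2 j z w) = b * w * z ^ t" for z w
    using M t by (simp add: main2_def)
  have E_nonneg: "0 \<le> E1 z w" "0 \<le> E2 z w" for z w
    by (simp_all add: E1_def E2_def)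
  show thesis
  proof (rule that[of "max C1 C2" "min \<delta>1 \<delta>2"])
    fix z w :: complex assume z: "0 < norm z" "norm z < min \<delta>1 \<delta>2" and w: "norm w \<le> norm z"
    have "norm (F z w - (z + a * z ^ (r + 1))) \<le> C1 * E1 z w"
      using C1(4)[of z w] z w coords unfolding sum1 cdet_cmul_add F_def by simp
    also have "\<dots> \<le> max C1 C2 * E1 z w"
      by (intro mult_right_mono E_nonneg) auto
    finally show "norm (F z w - (z + a * z ^ (r + 1))) \<le> max C1 C2 * (norm z ^ (r + 2) + norm w * norm z ^ k)"
      unfolding E1_def .
    have "norm (G z w - (w + b * w * z ^ t)) \<le> C2 * E2 z w"
      using C2(4)[of z w] z w coords unfolding sum2 cdet_cmul_add G_def by simp
    also have "\<dots> \<le> max C1 C2 * E2 z w"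
      by (intro mult_right_mono E_nonneg) auto
    finally show "norm (G z w - (w + b * w * z ^ t)) \<le> max C1 C2 *
        (norm w * norm z ^ (t + 1) + norm w ^ 2 * norm z ^ (k - 1) + norm z ^ (r + t - k + 2))"
      unfolding E2_def .
  qed (use C1 C2 in auto)
qed

section \<open>The domain of attraction\<close>

text \<open>Used for openness of the sector, because \<open>Arg\<close> is continuous only off the
  slit. The point 0 has to be excluded separately since \<open>Arg 0 = 0\<close>.\<close>

lemma not_nonpos_Reals_if_Arg_less_pi:
  assumes "z \<noteq> 0" "\<bar>Arg z\<bar> < pi"
  shows "z \<notin> \<real>\<^sub>\<le>\<^sub>0"
proof
  assume "z \<in> \<real>\<^sub>\<le>\<^sub>0"
  then obtain x where "z = of_real x" "x \<le> 0"
    by (auto elim: nonpos_Reals_cases)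
  then show False
    using assms by (simp add: Arg_of_real split: if_splits)
qed

text \<open>For t < r the exponent does not enter the inequality, and the root
  \<open>\<alpha>\<close> is the one that witnesses the director. For t = r any root works: a
  \<alpha>^r = -1/r turns the left side into (\<epsilon> - d)/r, where d is r times the real part of
  the director, so \<epsilon> < d is enough.\<close>

lemma transv_attracting_exponent:
  assumes "transv_attracting k r t a b" "a \<noteq> 0" "1 \<le> r" "t \<le> r"
  obtains \<alpha> :: complex and \<epsilon> :: real where "0 < \<epsilon>" "\<epsilon> \<le> 1 / 2" "\<alpha> ^ r = - 1 / (a * of_nat r)"
    "Re ((b - (if t = r then of_real (real r - real k + 1 + \<epsilon>) * a else 0)) * \<alpha> ^ t) < 0"
proof (cases "t < r")
  case True
  with assms(1) obtain \<alpha> where \<alpha>: "\<alpha> ^ r = - 1 / (a * of_nat r)" "Re (- b * \<alpha> ^ t) > 0"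
    unfolding transv_attracting_def by auto
  show thesis
    by (rule that[of "1/2" \<alpha>]) (use \<alpha> True in auto)
next
  case False
  then have "t = r" using assms by simp
  define d where "d = Re (b / a) - (real r - real k + 1)"
  define \<epsilon> where "\<epsilon> = min (1 / 2) (d / 2)"
  obtain \<alpha> where \<alpha>: "- 1 / (a * of_nat r) = \<alpha> ^ r"
    using exists_complex_root[of r "- 1 / (a * of_nat r)"] assms by auto
  have "Re ((b / a - (of_nat r - of_nat k + 1)) / of_nat r) = d / r"
    unfolding d_def by (simp add: Re_divide_of_nat)
  moreover have "0 < Re ((b / a - (of_nat r - of_nat k + 1)) / of_nat r)"
    using assms(1) False by (simp only: transv_attracting_def if_False)
  ultimately have "d / r > 0" by linarith
  then have "d > 0" using assms by (simp add: zero_less_divide_iff)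
  then have \<epsilon>: "0 < \<epsilon>" "\<epsilon> \<le> 1/2" "\<epsilon> < d" by (auto simp: \<epsilon>_def)
  have "(b - of_real (real r - real k + 1 + \<epsilon>) * a) * \<alpha> ^ r
      = (of_real (real r - real k + 1 + \<epsilon>) - b / a) / of_nat r"
    unfolding \<alpha>[symmetric] using assms by (simp add: field_simps)
  then have "Re ((b - of_real (real r - real k + 1 + \<epsilon>) * a) * \<alpha> ^ r) = (\<epsilon> - d) / r"
    unfolding d_def by (simp add: Re_divide_of_nat del: of_real_add of_real_diff)
  also have "\<dots> < 0"
    using \<epsilon> assms by (simp add: divide_less_0_iff)
  finally have neg: "Re ((b - of_real (real r - real k + 1 + \<epsilon>) * a) * \<alpha> ^ r) < 0" .
  show thesis
  proof (rule that[OF \<epsilon>(1,2) \<alpha>[symmetric]])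
    show "Re ((b - (if t = r then of_real (real r - real k + 1 + \<epsilon>) * a else 0)) * \<alpha> ^ t) < 0"
      using neg unfolding \<open>t = r\<close> if_P[OF refl] .
  qed
qed

theorem theoremA:
  fixes f :: "complex \<times> complex \<Rightarrow> complex \<times> complex"
    and p v w0 :: "complex \<times> complex"
    and c :: "nat \<Rightarrow> nat \<Rightarrow> complex \<times> complex"
    and \<rho> :: real and k r t :: nat and s :: enat and a :: complex
  assumes germ: "holo_germ_series f p \<rho> c"
    and fixed: "f p = p"
    and tangent: "(f has_derivative id) (at p)"
    and order: "1 \<le> k" "\<forall>j. 2 \<le> j \<and> j \<le> k \<longrightarrow> (\<forall>x. hpart c j x = 0)"
      "\<exists>x. hpart c (k + 1) x \<noteq> 0"
    and chardir: "char_dir (hpart c (k + 1)) v"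
    and coords: "cdet v w0 \<noteq> 0"
    and h1: "char_dir_of_degree c k s v"
    and h2: "nondeg_of_degree c k r v" "k < r" "enat r < s"
    and h3: "order_one_in_degree c k t v w0" "k \<le> t" "t \<le> r"
    and a_def: "hpart c (r + 1) v = cmul a v"
    and attracting: "transv_attracting k r t a (deriv (qfun c v w0 (t + 1)) 0)"
    and s_big: "enat (r + t - k) < s"
  shows "\<exists>D. open D \<and> D \<noteq> {} \<and> D \<subseteq> ball p \<rho> \<and> f ` D \<subseteq> D \<and>
           (\<forall>x\<in>D. ((\<lambda>n. (f ^^ n) x) \<longlongrightarrow> p) sequentially \<and>
                   converges_along (\<lambda>n. (f ^^ n) x) p v)"
proof -
  have "0 < \<rho>" using germ by (simp add: holo_germ_series_def)
  have "v \<noteq> 0" using chardir by (simp add: char_dir_def)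
  have cmul_0: "cmul 0 x = 0" for x by (simp add: prod_eq_iff)
  have "a \<noteq> 0"
  proof
    assume "a = 0"
    obtain l where l: "l \<noteq> 0" "cmul a v = cmul l v"
      using h2(1) a_def by (auto simp: nondeg_of_degree_def nondegenerate_char_dir_def)
    then have "l * fst v = 0" "l * snd v = 0"
      using \<open>a = 0\<close> by (simp_all add: prod_eq_iff)
    then show False using l \<open>v \<noteq> 0\<close> by (simp add: prod_eq_iff)
  qed
  define b where "b = deriv (qfun c v w0 (t + 1)) 0"
  define Z where "Z y = cdet y w0 / cdet v w0" for y
  define W where "W y = cdet v y / cdet v w0" for y
  define \<Phi> where "\<Phi> z w = cmul z v + cmul w w0" for z w
  define F where "F z w = Z (f (p + \<Phi> z w) - p)" for z w
  define G where "G z w = W (f (p + \<Phi> z w) - p)" for z w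
  have \<Phi>: "\<Phi> (Z y) (W y) = y" for y
    unfolding \<Phi>_def Z_def W_def using cdet_cmul_expand[OF coords] by simp
  have Z\<Phi>: "Z (\<Phi> z w) = z" "W (\<Phi> z w) = w" for z w
    unfolding \<Phi>_def Z_def W_def cdet_cmul_add using coords by simp_all

  have degenerate: "hpart c j v = 0" if "k + 1 \<le> j" "j \<le> r" for j
    using h2(1) that by (simp add: nondeg_of_degree_def degenerate_char_dir_def cmul_0)
  have char: "cdet v (hpart c j v) = 0" if j: "k + 1 \<le> j" "j \<le> r + t - k + 1" for j
  proof -
    \<comment> \<open>The strict inequality \<open>s_big\<close> gains one degree, exactly the one
      up to which the second component must have no pure power of z.\<close>
    have "enat (r + t - k + 1) \<le> s"
      using s_big by (cases s) auto
    moreover have "enat j \<le> enat (r + t - k + 1)"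
      using j by simp
    ultimately have "enat j \<le> s" by (rule order_trans[rotated])
    then obtain l where "hpart c j v = cmul l v"
      using h1 j by (auto simp: char_dir_of_degree_def char_dir_def)
    then show ?thesis by (simp add: cdet_def)
  qed
  have order1: "deriv (qfun c v w0 j) 0 = 0" if "k + 1 \<le> j" "j \<le> t" for j
    using h3(1) that by (simp add: order_one_in_degree_def vanish_order_gt_one_def)
  obtain C \<delta>0 where C: "0 \<le> C" and \<delta>0: "0 < \<delta>0" "\<delta>0 < 1"
    and F_est: "\<And>z w. \<lbrakk>0 < norm z; norm z < \<delta>0; norm w \<le> norm z\<rbrakk> \<Longrightarrow>
      norm (F z w - (z + a * z ^ (r + 1))) \<le> C * (norm z ^ (r + 2) + norm w * norm z ^ k)"
    and G_est: "\<And>z w. \<lbrakk>0 < norm z; norm z < \<delta>0; norm w \<le> norm z\<rbrakk> \<Longrightarrow>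
      norm (G z w - (w + b * w * z ^ t)) \<le>
        C * (norm w * norm z ^ (t + 1) + norm w ^ 2 * norm z ^ (k - 1) + norm z ^ (r + t - k + 2))"
    unfolding F_def G_def Z_def W_def \<Phi>_def b_def
    by (rule char_germ_estimates[OF germ fixed tangent order(1,2) coords h3(2,3) degenerate a_def char order1])
      (assumption+, rule that[unfolded F_def G_def Z_def W_def \<Phi>_def b_def])

  obtain \<alpha> \<epsilon> where \<epsilon>: "0 < \<epsilon>" "\<epsilon> \<le> 1 / 2" and \<alpha>: "\<alpha> ^ r = - 1 / (a * of_nat r)"
    and director: "Re ((b - (if t = r then of_real (real r - real k + 1 + \<epsilon>) * a else 0)) * \<alpha> ^ t) < 0"
    using transv_attracting_exponent[OF attracting[folded b_def] \<open>a \<noteq> 0\<close> _ h3(3)] h2(2) order(1)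
    by (metis le_trans less_imp_le)
  define m where "m = real r - real k + 1 + \<epsilon>"
  have "m \<ge> 2" using h2(2) \<epsilon> by (simp add: m_def)
  define N where "N = norm v + norm w0 + 1"
  have "N > 0" by (simp add: N_def add_nonneg_pos)
  \<comment> \<open>The bound \<rho>/N will keep the domain inside \<open>ball p \<rho>\<close>,
    since |x - p| \<le> N |Z (x - p)| there.\<close>
  define \<delta>1 where "\<delta>1 = min \<delta>0 (\<rho> / N)"
  have \<delta>1: "0 < \<delta>1" "\<delta>1 \<le> \<delta>0" "\<delta>1 \<le> \<rho> / N"
    using \<delta>0 \<open>0 < \<rho>\<close> \<open>N > 0\<close> by (auto simp: \<delta>1_def)

  have w_le: "norm w \<le> norm z ^ 2" "norm w \<le> norm z"
    if "0 < norm z" "norm z < \<delta>1" "norm w < norm z powr m" for z w :: complex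
  proof -
    have "norm z < 1" using that \<delta>1 \<delta>0 by linarith
    have "norm z powr m \<le> norm z powr 2"
      using that \<open>norm z < 1\<close> \<open>m \<ge> 2\<close> by (intro powr_mono') auto
    also have "\<dots> = norm z ^ 2" using that by simp
    finally show 1: "norm w \<le> norm z ^ 2" using that by simp
    have "norm z ^ 2 \<le> norm z ^ 1"
      using \<open>norm z < 1\<close> by (intro power_decreasing) auto
    then show "norm w \<le> norm z" using 1 by simp
  qed

  have F_est': "norm (F z w - (z + a * z ^ (r + 1))) \<le> 3 * C * norm z ^ (r + 1) * norm z powr \<epsilon>"
    and G_est': "norm (G z w - (w + b * w * z ^ t)) \<le> 3 * C * norm z powr m * norm z ^ t * norm z powr \<epsilon>"
    if z: "0 < norm z" "norm z < \<delta>1" and w: "norm w < norm z powr m" for z w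
  proof -
    define q where "q = norm z"
    have q: "0 < q" "q < 1" using z \<delta>1 \<delta>0 by (auto simp: q_def)
    have pw: "q ^ n = q powr n" for n using q by (simp add: powr_realpow)
    have mono: "q powr x \<le> q powr y" if "y \<le> x" for x y
      using q that by (intro powr_mono') auto
    have nw: "norm w \<le> q powr m" using w by (simp add: q_def)
    have "q ^ (r + 2) \<le> q ^ (r + 1) * q powr \<epsilon>"
      unfolding pw powr_add[symmetric] using \<epsilon> by (intro mono) simp
    \<comment> \<open>This fixes the choice of \<open>m\<close>: m + k = r + 1 + \<epsilon>.\<close>
    moreover have "norm w * q ^ k \<le> q ^ (r + 1) * q powr \<epsilon>"
    proof -
      have "norm w * q ^ k \<le> q powr m * q ^ k"
        using nw q by (intro mult_right_mono) auto
      also have "\<dots> = q ^ (r + 1) * q powr \<epsilon>"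
        unfolding pw powr_add[symmetric] by (simp add: m_def algebra_simps)
      finally show ?thesis .
    qed
    moreover have "0 \<le> q ^ (r + 1) * q powr \<epsilon>" using q by simp
    ultimately have "q ^ (r + 2) + norm w * q ^ k \<le> 3 * (q ^ (r + 1) * q powr \<epsilon>)"
      by linarith
    from order_trans[OF F_est mult_left_mono[OF this[unfolded q_def] C]]
    show "norm (F z w - (z + a * z ^ (r + 1))) \<le> 3 * C * norm z ^ (r + 1) * norm z powr \<epsilon>"
      using z w_le(2)[OF z w] \<delta>1 by (simp add: mult_ac)

    define R where "R = q powr m * q ^ t * q powr \<epsilon>"
    have "norm w * q ^ (t + 1) \<le> R"
    proof -
      have "norm w * q ^ (t + 1) \<le> q powr m * q ^ (t + 1)"
        using nw q by (intro mult_right_mono) auto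
      also have "\<dots> \<le> R"
        unfolding R_def pw powr_add[symmetric] using \<epsilon> by (intro mono) simp
      finally show ?thesis .
    qed
    \<comment> \<open>Comparing exponents, 2m + k - 1 \<ge> m + t + \<epsilon> amounts to t \<le>
      r.\<close>
    moreover have "norm w ^ 2 * q ^ (k - 1) \<le> R"
    proof -
      have "norm w ^ 2 * q ^ (k - 1) \<le> (q powr m * q powr m) * q ^ (k - 1)"
        unfolding power2_eq_square using nw q by (intro mult_right_mono mult_mono) auto
      also have "\<dots> \<le> R"
        unfolding R_def pw powr_add[symmetric] using \<epsilon> order(1) h3(3)
        by (intro mono) (simp add: m_def of_nat_diff)
      finally show ?thesis .
    qed
    \<comment> \<open>Comparing exponents, r + t - k + 2 \<ge> m + t + \<epsilon> amounts to
      \<epsilon> \<le> 1/2.\<close>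
    moreover have "q ^ (r + t - k + 2) \<le> R"
      unfolding R_def pw powr_add[symmetric] using \<epsilon> h2(2)
      by (intro mono) (simp add: m_def of_nat_diff)
    ultimately have "norm w * q ^ (t + 1) + norm w ^ 2 * q ^ (k - 1) + q ^ (r + t - k + 2) \<le> 3 * R"
      by linarith
    from order_trans[OF G_est mult_left_mono[OF this[unfolded q_def] C]]
    show "norm (G z w - (w + b * w * z ^ t)) \<le> 3 * C * norm z powr m * norm z ^ t * norm z powr \<epsilon>"
      using z w_le(2)[OF z w] \<delta>1 by (simp add: R_def q_def mult_ac)
  qed

  obtain \<phi> \<delta> \<kappa> :: real where \<phi>: "0 < \<phi>" "\<phi> < pi" and \<delta>: "0 < \<delta>" "\<delta> \<le> \<delta>1" and "0 < \<kappa>"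
    and step: "\<And>z w. \<lbrakk>0 < norm z; norm z < \<delta>; \<bar>Arg (z / \<alpha>)\<bar> < \<phi>; norm w < norm z powr m\<rbrakk> \<Longrightarrow>
      0 < norm (F z w) \<and> norm (F z w) \<le> norm z * exp (- \<kappa> * norm z ^ r) \<and>
      \<bar>Arg (F z w / \<alpha>)\<bar> < \<phi> \<and> norm (G z w) < norm (F z w) powr m"
  proof (rule attracting_region[of a t r \<alpha> m "3 * C" \<epsilon> \<delta>1 b F G])
    show "1 \<le> t" using order(1) h3(2) by simp
    show "Re ((b - (if t = r then of_real m * a else 0)) * \<alpha> ^ t) < 0"
      unfolding m_def by (rule director)
  qed (use \<open>a \<noteq> 0\<close> h3 \<alpha> \<open>m \<ge> 2\<close> C \<epsilon> \<delta>1 F_est' G_est' that in auto)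

  define D where "D = {x. 0 < norm (Z (x - p)) \<and> norm (Z (x - p)) < \<delta> \<and>
      \<bar>Arg (Z (x - p) / \<alpha>)\<bar> < \<phi> \<and> norm (W (x - p)) < norm (Z (x - p)) powr m}"
  have "\<alpha> \<noteq> 0"
  proof
    assume "\<alpha> = 0"
    then have "\<alpha> ^ r = 0" using h2(2) by simp
    then show False using \<alpha> \<open>a \<noteq> 0\<close> h2(2) by simp
  qed
  have cont: "continuous_on S (\<lambda>x. Z (x - p))" "continuous_on S (\<lambda>x. W (x - p))" for S
    unfolding Z_def W_def cdet_def using coords
    by (intro continuous_intros; simp add: cdet_def)+

  have "open D"
  proof -
    define U where "U = (\<lambda>x. Z (x - p) / \<alpha>) -` (- \<real>\<^sub>\<le>\<^sub>0)"
    have "open U"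
      unfolding U_def by (intro open_vimage continuous_intros cont) (use \<open>\<alpha> \<noteq> 0\<close> in auto)
    have "open (U \<inter> (\<lambda>x. Arg (Z (x - p) / \<alpha>)) -` {-\<phi><..<\<phi>})"
      by (rule continuous_open_preimage[OF _ \<open>open U\<close> open_greaterThanLessThan])
        (auto intro!: continuous_intros cont simp: U_def \<open>\<alpha> \<noteq> 0\<close>)
    moreover have "open {x. 0 < norm (Z (x - p))}" "open {x. norm (Z (x - p)) < \<delta>}"
      by (intro open_Collect_less continuous_intros cont)+
    moreover have "open {x. norm (W (x - p)) < norm (Z (x - p)) powr m}"
      by (intro open_Collect_less continuous_on_powr' continuous_intros cont) (use \<open>m \<ge> 2\<close> in auto)
    ultimately have "open (U \<inter> (\<lambda>x. Arg (Z (x - p) / \<alpha>)) -` {-\<phi><..<\<phi>} \<inter> {x. 0 < norm (Z (x - p))} \<inter>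
        {x. norm (Z (x - p)) < \<delta>} \<inter> {x. norm (W (x - p)) < norm (Z (x - p)) powr m})"
      by - (assumption | rule open_Int)+
    also have "\<dots> = D"
      using \<phi> \<open>\<alpha> \<noteq> 0\<close> not_nonpos_Reals_if_Arg_less_pi[of "Z (_ - p) / \<alpha>"] by (auto simp: D_def U_def)
    finally show ?thesis .
  qed
  moreover have "D \<noteq> {}"
  proof -
    \<comment> \<open>Witness: the point of the attracting axis with |z| = \<delta>/2 and w =
      0.\<close>
    define x where "x = \<delta> / 2 / norm \<alpha>"
    define z where "z = of_real x * \<alpha>"
    have "x > 0" using \<delta> \<open>\<alpha> \<noteq> 0\<close> by (simp add: x_def)
    then have "norm z = \<delta> / 2" "Arg (z / \<alpha>) = 0"
      using \<delta> \<open>\<alpha> \<noteq> 0\<close> by (simp_all add: z_def norm_mult Arg_of_real) (simp add: x_def)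
    moreover have "z \<noteq> 0" using \<open>x > 0\<close> \<open>\<alpha> \<noteq> 0\<close> by (simp add: z_def)
    moreover have "Z (\<Phi> z 0) = z" "W (\<Phi> z 0) = 0" by (rule Z\<Phi>)+
    ultimately have "p + \<Phi> z 0 \<in> D"
      using \<delta> \<phi> by (simp add: D_def)
    then show ?thesis by blast
  qed
  moreover have norm_le: "norm (x - p) \<le> norm (Z (x - p)) * N" if "x \<in> D" for x
  proof -
    define y where "y = x - p"
    have "norm (W y) \<le> norm (Z y)"
      using that \<delta> by (intro w_le) (auto simp: D_def y_def)
    have "norm y = norm (\<Phi> (Z y) (W y))" by (simp only: \<Phi>)
    also have "\<dots> \<le> norm (Z y) * norm v + norm (W y) * norm w0"
      unfolding \<Phi>_def using norm_triangle_ineq[of "cmul (Z y) v" "cmul (W y) w0"] by (simp add: norm_cmul)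
    also have "\<dots> \<le> norm (Z y) * norm v + norm (Z y) * norm w0"
      using \<open>norm (W y) \<le> norm (Z y)\<close> by (intro add_mono mult_right_mono) auto
    also have "\<dots> \<le> norm (Z y) * N" by (simp add: N_def algebra_simps)
    finally show ?thesis by (simp add: y_def)
  qed
  moreover have "D \<subseteq> ball p \<rho>"
  proof
    fix x assume x: "x \<in> D"
    have "norm (Z (x - p)) * N < \<rho> / N * N"
      using x \<delta> \<delta>1 \<open>N > 0\<close> by (intro mult_strict_right_mono) (auto simp: D_def)
    then show "x \<in> ball p \<rho>"
      using norm_le[OF x] \<open>N > 0\<close> by (simp add: dist_norm norm_minus_commute)
  qed
  moreover have f_D: "f x \<in> D \<and> norm (Z (f x - p)) \<le> norm (Z (x - p)) * exp (- \<kappa> * norm (Z (x - p)) ^ r)"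
    if "x \<in> D" for x
  proof -
    define z w where "z = Z (x - p)" and "w = W (x - p)"
    have "p + \<Phi> z w = x" unfolding z_def w_def \<Phi> by simp
    then have FG: "Z (f x - p) = F z w" "W (f x - p) = G z w"
      by (simp_all add: F_def G_def)
    have z: "0 < norm z" "norm z < \<delta>"
      using that by (auto simp: D_def z_def)
    have *: "0 < norm (F z w) \<and> norm (F z w) \<le> norm z * exp (- \<kappa> * norm z ^ r) \<and>
      \<bar>Arg (F z w / \<alpha>)\<bar> < \<phi> \<and> norm (G z w) < norm (F z w) powr m"
      using that by (intro step) (auto simp: D_def z_def w_def)
    have "norm z * exp (- \<kappa> * norm z ^ r) \<le> norm z * 1"
      using \<open>0 < \<kappa>\<close> by (intro mult_left_mono) auto
    then have "norm (F z w) < \<delta>" using * z by linarith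
    then show ?thesis using * by (simp add: D_def FG z_def[symmetric])
  qed
  moreover have "(\<lambda>n. (f ^^ n) x) \<longlonglongrightarrow> p \<and> converges_along (\<lambda>n. (f ^^ n) x) p v" if "x \<in> D" for x
  proof -
    define y where "y n = (f ^^ n) x - p" for n
    have D: "(f ^^ n) x \<in> D" for n
      using that f_D by (induction n) auto
    have q_lim: "(\<lambda>n. norm (Z (y n))) \<longlonglongrightarrow> 0"
      using f_D[OF D] \<open>0 < \<kappa>\<close> by (intro tendsto_0_if_contracting[of _ \<kappa> r]) (auto simp: y_def)
    have "y \<longlonglongrightarrow> 0"
    proof (rule Lim_null_comparison)
      show "\<forall>\<^sub>F n in sequentially. norm (y n) \<le> norm (Z (y n)) * N"
        using norm_le[OF D] by (simp add: y_def)
      show "(\<lambda>n. norm (Z (y n)) * N) \<longlonglongrightarrow> 0"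
        using q_lim by (rule tendsto_mult_left_zero)
    qed
    then have lim: "(\<lambda>n. (f ^^ n) x) \<longlonglongrightarrow> p"
      unfolding y_def by (rule LIM_zero_cancel)
    have Z_pos: "0 < norm (Z (y n))" for n
      using D[of n] by (simp add: D_def y_def)
    \<comment> \<open>Tangency to [v]: m \<ge> 2 gives |w| \<le> |z|^2, so the slope w/z tends to 0
      together with z, and 1/z is the normalizing factor for \<open>converges_along\<close>.\<close>
    have "(\<lambda>n. W (y n) / Z (y n)) \<longlonglongrightarrow> 0"
    proof (rule Lim_null_comparison[OF _ q_lim], rule always_eventually, rule allI)
      fix n
      have "norm (W (y n)) \<le> norm (Z (y n)) ^ 2"
        using D[of n] \<delta> by (intro w_le) (auto simp: D_def y_def)
      then show "norm (W (y n) / Z (y n)) \<le> norm (Z (y n))"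
        using Z_pos[of n] by (simp add: norm_divide divide_le_eq power2_eq_square)
    qed
    then have "(\<lambda>n. v + cmul (W (y n) / Z (y n)) w0) \<longlonglongrightarrow> v + cmul 0 w0"
      unfolding cmul_def by (intro tendsto_intros)
    moreover have "cmul (1 / Z (y n)) (y n) = v + cmul (W (y n) / Z (y n)) w0" for n
    proof -
      have "cmul (1 / Z (y n)) (\<Phi> (Z (y n)) (W (y n))) = v + cmul (W (y n) / Z (y n)) w0"
        using Z_pos[of n] by (simp add: \<Phi>_def prod_eq_iff add_divide_distrib)
      then show ?thesis by (simp only: \<Phi>)
    qed
    ultimately have "(\<lambda>n. cmul (1 / Z (y n)) (y n)) \<longlonglongrightarrow> v"
      by (simp add: cmul_0)
    moreover have "(f ^^ n) x \<noteq> p" for n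
      using Z_pos[of n] by (auto simp: y_def Z_def cdet_def)
    ultimately have "converges_along (\<lambda>n. (f ^^ n) x) p v"
      unfolding converges_along_def y_def by auto
    with lim show ?thesis ..
  qed
  ultimately show ?thesis by blast
qed

end
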